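(* Let $\Gamma$ be a finite graph. The intersection $\bigcap_{c=1}^{\infty}H_c$ is the trivial subgroup of $\mathrm{Out}(A_\Gamma)$.
   Context: $\Gamma$ is a finite simple graph; $A_\Gamma$ is the group generated by the vertices of $\Gamma$ with relations $[v,w]=1$ for $v,w$ adjacent. Let $\gamma_1=A_\Gamma$, $\gamma_{c+1}=[\gamma_c,A_\Gamma]$ be the lower central series. For $c\ge0$, $G_c$ is the kernel of the natural map $\mathrm{Aut}(A_\Gamma)\to\mathrm{Aut}(A_\Gamma/\gamma_{c+1})$, and $H_c$ is the image of $G_c$ in $\mathrm{Out}(A_\Gamma)$. *)

theory Defs
  imports "HOL-Algebra.Bij" "HOL-Algebra.Generated_Groups" "Graph_Theory.Pair_Digraph"
begin

section \<open>Group presentations\<close>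

text \<open>The letter \<open>(x, True)\<close> stands for the generator \<open>x\<close>, and \<open>(x, False)\<close> for its formal inverse.\<close>

type_synonym 'a word = "('a \<times> bool) list"

definition words :: "'a set \<Rightarrow> 'a word set"
  where "words X = lists (X \<times> UNIV)"

inductive_set pres_rel :: "'a set \<Rightarrow> 'a word set \<Rightarrow> ('a word \<times> 'a word) set"
  for X :: "'a set" and R :: "'a word set" where
  refl: "u \<in> words X \<Longrightarrow> (u, u) \<in> pres_rel X R"
| sym: "(u, v) \<in> pres_rel X R \<Longrightarrow> (v, u) \<in> pres_rel X R"
| trans: "(u, v) \<in> pres_rel X R \<Longrightarrow> (v, w) \<in> pres_rel X R \<Longrightarrow> (u, w) \<in> pres_rel X R"
| cancel: "u \<in> words X \<Longrightarrow> v \<in> words X \<Longrightarrow> x \<in> X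
    \<Longrightarrow> (u @ [(x, b), (x, \<not> b)] @ v, u @ v) \<in> pres_rel X R"
| relator: "u \<in> words X \<Longrightarrow> v \<in> words X \<Longrightarrow> r \<in> R \<Longrightarrow> r \<in> words X
    \<Longrightarrow> (u @ r @ v, u @ v) \<in> pres_rel X R"

definition presented_group :: "'a set \<Rightarrow> 'a word set \<Rightarrow> 'a word set monoid"
  where "presented_group X R =
    \<lparr>carrier = words X // pres_rel X R,
     monoid.mult = \<lambda>A B. \<Union>a\<in>A. \<Union>b\<in>B. pres_rel X R `` {a @ b},
     one = pres_rel X R `` {[]}\<rparr>"

text \<open>A finite simple graph is a \<^locale>\<open>pair_graph\<close>, in which an edge between \<open>v\<close> and \<open>w\<close> is present
  as both arcs \<open>(v, w)\<close> and \<open>(w, v)\<close>.\<close>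

definition raag :: "'v pair_pre_digraph \<Rightarrow> 'v word set monoid"
  where "raag \<Gamma> = presented_group (pverts \<Gamma>)
    {[(v, True), (w, True), (v, False), (w, False)] | v w. (v, w) \<in> parcs \<Gamma>}"


section \<open>Lower central series\<close>

definition commutator_subgroup :: "('a, 'b) monoid_scheme \<Rightarrow> 'a set \<Rightarrow> 'a set \<Rightarrow> 'a set"
  where "commutator_subgroup G H K =
    generate G (\<Union>h\<in>H. \<Union>k\<in>K. {h \<otimes>\<^bsub>G\<^esub> k \<otimes>\<^bsub>G\<^esub> inv\<^bsub>G\<^esub> h \<otimes>\<^bsub>G\<^esub> inv\<^bsub>G\<^esub> k})"

text \<open>The series is indexed from 1; the value at index 0 is a dummy and is never used.\<close>

fun lower_central_series :: "('a, 'b) monoid_scheme \<Rightarrow> nat \<Rightarrow> 'a set" where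
  "lower_central_series G 0 = carrier G"
| "lower_central_series G (Suc 0) = carrier G"
| "lower_central_series G (Suc (Suc c)) =
     commutator_subgroup G (lower_central_series G (Suc c)) (carrier G)"


section \<open>Outer automorphisms and the subgroups \<open>G\<^sub>c\<close> and \<open>H\<^sub>c\<close>\<close>

definition Inn :: "('a, 'b) monoid_scheme \<Rightarrow> ('a \<Rightarrow> 'a) set"
  where "Inn G = (\<lambda>g. \<lambda>x\<in>carrier G. g \<otimes>\<^bsub>G\<^esub> x \<otimes>\<^bsub>G\<^esub> inv\<^bsub>G\<^esub> g) ` carrier G"

definition Out :: "('a, 'b) monoid_scheme \<Rightarrow> ('a \<Rightarrow> 'a) set monoid"
  where "Out G = AutoGroup G Mod Inn G"

text \<open>For \<open>N\<close> characteristic in \<open>G\<close>, an automorphism \<open>\<alpha>\<close> of \<open>G\<close> induces on \<open>G Mod N\<close> the automorphism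
  that sends the coset \<open>N #> x\<close> to \<open>N #> \<alpha> x\<close>, which is the image of the set \<open>N #> x\<close> under \<open>\<alpha>\<close>.\<close>

definition induced_auto :: "('a, 'b) monoid_scheme \<Rightarrow> 'a set \<Rightarrow> ('a \<Rightarrow> 'a) \<Rightarrow> 'a set \<Rightarrow> 'a set"
  where "induced_auto G N \<alpha> = (\<lambda>C\<in>carrier (G Mod N). \<alpha> ` C)"

definition G_sub :: "('a, 'b) monoid_scheme \<Rightarrow> nat \<Rightarrow> ('a \<Rightarrow> 'a) set"
  where "G_sub A c =
    kernel (AutoGroup A) (AutoGroup (A Mod lower_central_series A (Suc c)))
      (induced_auto A (lower_central_series A (Suc c)))"

definition H_sub :: "('a, 'b) monoid_scheme \<Rightarrow> nat \<Rightarrow> ('a \<Rightarrow> 'a) set set"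
  where "H_sub A c = (\<lambda>\<alpha>. Inn A #>\<^bsub>AutoGroup A\<^esub> \<alpha>) ` G_sub A c"

end

(* Let L be the action of the right-angled Artin group A on integer-valued functions on the trace
monoid of the graph that is induced by the Magnus map v |-> 1 + X_v.  Elements of the c-th term of
the lower central series act as 1 + (terms raising the degree by at least c), so an outer
automorphism in all H_c is represented by alpha such that, for every c, alpha acts on the vertices
as conjugation by some g_c up to degree c.

Each alpha(x) is conjugate to x in A.  Take w of minimal syllable length in the conjugacy class of
alpha(x).  Up to any given degree w - 1 is conjugate to X_x, so (w - 1)^2 has no square-free
monomial.  But if w = y_1^e_1 ... y_k^e_k and (y_1 ... y_k)^2 is square-free, then its coefficient
in (w - 1)^2 is (e_1 ... e_k)^2, which is not 0.  Hence two syllables of w merge cyclically;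
by minimality and the abelianization this leaves only w = x w' with w' supported on the link of x,
and the same argument for w' gives w' = 1.

The conjugators can be aligned one vertex at a time.  Suppose alpha fixes the vertices in S and
alpha(x) = r x r^-1, with the pair (conjugator, r) chosen so that r has minimal syllable length.
Up to a high degree g_c commutes with S, and r^-1 g_c commutes with x; since the centralizer of
1 + X_v is supported on the star of v, comparing the coefficients of g_c and r (r^-1 g_c) at the
trace of r shows that r = 1. *)

theory Submission
  imports Defs "HOL-Algebra.Group_Action"
begin

section \<open>Traces over a commutation graph\<close>

locale commutation_graph =
  fixes adj :: "'v \<Rightarrow> 'v \<Rightarrow> bool"
  assumes adj_sym: "adj v w \<Longrightarrow> adj w v"
    and adj_irrefl [simp]: "\<not> adj v v"
begin

text \<open>Lists stand for traces: \<open>strip v t = Some u\<close> means that some occurrence of \<open>v\<close> in \<open>t\<close> can be moved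
  to the front by commutations, leaving \<open>u\<close>. All functions below are evaluated on lists directly, so
  that no quotient by the commutation relation is needed.\<close>

primrec strip :: "'v \<Rightarrow> 'v list \<Rightarrow> 'v list option" where
  "strip v [] = None"
| "strip v (z # t) =
    (if z = v then Some t else if adj v z then map_option ((#) z) (strip v t) else None)"

text \<open>The tail is searched first, so the last occurrence of \<open>v\<close> is the one
  removed; an earlier one could not pass it, because \<open>v\<close> is not adjacent to
  itself.\<close>

primrec rstrip :: "'v \<Rightarrow> 'v list \<Rightarrow> 'v list option" where
  "rstrip v [] = None"
| "rstrip v (z # t) =
    (case rstrip v t of
       Some u \<Rightarrow> Some (z # u)
     | None \<Rightarrow> if z = v \<and> (\<forall>y\<in>set t. adj v y) then Some t else None)"

text \<open>Only squares of single letters are excluded: x y x y with distinct non-adjacent x and y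
  is square-free.\<close>

primrec squarefree_trace :: "'v list \<Rightarrow> bool" where
  "squarefree_trace [] \<longleftrightarrow> True"
| "squarefree_trace (z # t) \<longleftrightarrow> strip z t = None \<and> squarefree_trace t"

lemma strip_length: "strip v t = Some u \<Longrightarrow> length t = Suc (length u)"
  by (induction t arbitrary: u) (auto split: if_splits)

lemma strip_set: "strip v t = Some u \<Longrightarrow> set t = insert v (set u)"
  by (induction t arbitrary: u) (auto split: if_splits)

lemma strip_None: "v \<notin> set t \<Longrightarrow> strip v t = None"
  by (induction t) auto

lemma strip_append:
  "strip v (p @ r) = (case strip v p of
     Some p' \<Rightarrow> Some (p' @ r)
   | None \<Rightarrow> if \<forall>y\<in>set p. adj v y then map_option ((@) p) (strip v r) else None)"
  by (induction p) (cases "strip v r"; auto split: option.splits)+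

lemma rstrip_snoc: "rstrip v (t @ [v]) = Some t"
  by (induction t) auto

lemma strip_commute:
  assumes "adj v w"
  shows "Option.bind (strip v t) (strip w) = Option.bind (strip w t) (strip v)"
proof (induction t)
  case (Cons z t)
  then show ?case using assms adj_sym[OF assms]
    by (cases "strip v t"; cases "strip w t") (auto split: if_splits)
qed auto

text \<open>Cancelling on the left and on the right are independent. If \<open>v = w\<close> and one
  occurrence is free on both sides, then it is the only one, and both sides are
  \<open>None\<close>.\<close>

lemma strip_rstrip_commute:
  "Option.bind (strip v t) (rstrip w) = Option.bind (rstrip w t) (strip v)"
proof (induction t)
  case (Cons z t)
  consider "z = v" | "z \<noteq> v" "adj v z" | "z \<noteq> v" "\<not> adj v z" by blast
  then show ?case
  proof cases
    case 1
    have "strip v t = None" if "\<forall>y\<in>set t. adj v y" using that strip_None by force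
    with 1 show ?thesis by (auto split: option.splits)
  next
    case 2
    have *: "\<exists>y\<in>set t'. \<not> adj w y"
      if "rstrip w t = Some u" "strip v t = Some t'" "w \<noteq> v" for u t'
    proof -
      have "w \<in> set t" using that(1) by (induction t arbitrary: u) (auto split: option.splits if_splits)
      then show ?thesis using strip_set[OF that(2)] that(3) by (auto intro!: bexI[of _ w])
    qed
    show ?thesis using 2 Cons *[of _ "the (strip v t)"] strip_set[of v t] adj_sym[of v z]
      by (cases "strip v t"; cases "rstrip w t") (auto split: option.splits if_splits)
  next
    case 3
    have "strip v t = None" if "\<forall>y\<in>set t. adj z y"
      using that 3 adj_sym strip_None by metis
    with 3 show ?thesis using Cons by (auto split: option.splits)
  qed
qed auto

lemma strip_squarefree: "strip v t = Some u \<Longrightarrow> squarefree_trace t \<Longrightarrow> squarefree_trace u"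
proof (induction t arbitrary: u)
  case (Cons z t)
  show ?case
  proof (cases "z = v")
    case False
    then obtain u' where u': "adj v z" "strip v t = Some u'" "u = z # u'"
      using Cons.prems by (auto split: if_splits)
    \<comment> \<open>\<open>z\<close> could be stripped after \<open>v\<close> only if it could be
      stripped from \<open>t\<close> already, against square-freeness of
      \<open>z # t\<close>.\<close>
    have "strip z u' = None" using strip_commute[OF u'(1), of t] u'(2) Cons.prems by simp
    then show ?thesis using Cons u' by auto
  qed (use Cons in auto)
qed auto

lemma squarefree_strip_twice:
  "strip v t = Some u \<Longrightarrow> squarefree_trace t \<Longrightarrow> strip v u = None"
  by (induction t arbitrary: u) (auto split: if_splits)

text \<open>A square that is new in the product pairs a last letter of \<open>t\<close> with an
  equal first letter of \<open>t'\<close>. For \<open>t = t'\<close> such a pair is a cyclic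
  merge.\<close>

lemma squarefree_append:
  assumes "squarefree_trace t" "squarefree_trace t'"
    and "\<And>y. rstrip y t = None \<or> strip y t' = None"
  shows "squarefree_trace (t @ t')"
  using assms(1,3)
proof (induction t)
  case (Cons z t)
  have "rstrip y t = None \<or> strip y t' = None" for y
    using Cons.prems(2)[of y] by (auto split: option.splits)
  moreover have "strip z (t @ t') = None"
    using Cons.prems(1) Cons.prems(2)[of z] by (auto simp: strip_append split: option.splits)
  ultimately show ?case using Cons by auto
qed (use assms in auto)

text \<open>Since no \<open>v\<close> can be stripped on the right of \<open>u\<close>, the
  occurrence removed on the left is the one that is free on the right, so all other letters let it
  pass.\<close>

lemma strip_rstrip_single:
  "strip v t = Some u \<Longrightarrow> rstrip v t \<noteq> None \<Longrightarrow> rstrip v u = None \<Longrightarrow> z \<in> set u \<Longrightarrow> adj v z"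
proof (induction t arbitrary: u)
  case (Cons y t)
  then show ?case by (auto split: if_splits option.splits)
qed auto

section \<open>Evaluation at stripped lists\<close>

definition strip_val :: "('v list \<Rightarrow> int) \<Rightarrow> 'v list option \<Rightarrow> int" where
  "strip_val f r = (case r of None \<Rightarrow> 0 | Some u \<Rightarrow> f u)"

lemma strip_val_simps [simp]: "strip_val f None = 0" "strip_val f (Some u) = f u"
  by (auto simp: strip_val_def)

text \<open>On such a set the values of \<open>L g f\<close> depend only on the values of
  \<open>f\<close> there (\<open>L_cong_on\<close>). The instances are lists of bounded length,
  square-free lists, and lists without certain last letters.\<close>

definition strip_closed :: "'v list set \<Rightarrow> bool" where
  "strip_closed B \<longleftrightarrow> (\<forall>v t u. t \<in> B \<longrightarrow> strip v t = Some u \<longrightarrow> u \<in> B)"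

lemma strip_closedD: "strip_closed B \<Longrightarrow> t \<in> B \<Longrightarrow> strip v t = Some u \<Longrightarrow> u \<in> B"
  by (auto simp: strip_closed_def)

lemma strip_closed_length: "strip_closed {t. length t < n}"
  by (auto simp: strip_closed_def dest: strip_length)

lemma strip_closed_squarefree: "strip_closed (Collect squarefree_trace)"
  by (auto simp: strip_closed_def intro: strip_squarefree)

lemma strip_closed_rstrip: "strip_closed {t. \<forall>y\<in>S. rstrip y t = None}"
  unfolding strip_closed_def
proof (intro allI impI)
  fix v t u assume "t \<in> {t. \<forall>y\<in>S. rstrip y t = None}" "strip v t = Some u"
  then show "u \<in> {t. \<forall>y\<in>S. rstrip y t = None}"
    using strip_rstrip_commute[of v t] by auto
qed

lemma strip_closed_Int: "strip_closed A \<Longrightarrow> strip_closed B \<Longrightarrow> strip_closed (A \<inter> B)"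
  by (auto simp: strip_closed_def)

lemma strip_val_bind: "strip_val f (Option.bind r g) = strip_val (\<lambda>u. strip_val f (g u)) r"
  by (cases r) simp_all

lemma strip_val_add: "strip_val (\<lambda>u. f u + f' u) r = strip_val f r + strip_val f' r"
  by (cases r) simp_all

end

lemma (in group) inv_cancel_left [simp]:
  "a \<in> carrier G \<Longrightarrow> z \<in> carrier G \<Longrightarrow> inv a \<otimes> (a \<otimes> z) = z"
  "a \<in> carrier G \<Longrightarrow> z \<in> carrier G \<Longrightarrow> a \<otimes> (inv a \<otimes> z) = z"
  by (simp_all flip: m_assoc)

lemma (in group) commute_int_pow:
  fixes k :: int
  assumes "x \<in> carrier G" "y \<in> carrier G" "x \<otimes> y = y \<otimes> x"
  shows "x [^] k \<otimes> y = y \<otimes> x [^] k"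
proof -
  have inv: "inv a \<otimes> y = y \<otimes> inv a" if "a \<in> carrier G" "a \<otimes> y = y \<otimes> a" for a
  proof -
    have "inv a \<otimes> y = inv a \<otimes> ((y \<otimes> a) \<otimes> inv a)" using that assms by (simp add: m_assoc)
    also have "\<dots> = inv a \<otimes> ((a \<otimes> y) \<otimes> inv a)" using that(2) by simp
    also have "\<dots> = y \<otimes> inv a" using that(1) assms(2) by (simp add: m_assoc)
    finally show ?thesis .
  qed
  have pow: "x [^] n \<otimes> y = y \<otimes> x [^] n" for n :: nat
    using assms by (intro group_commutes_pow)
  show ?thesis
  proof (cases "k < 0")
    case True
    then show ?thesis
      unfolding int_pow_def2 using inv[OF nat_pow_closed[OF assms(1)] pow] by (simp only: if_True)
  next
    case False
    then show ?thesis unfolding int_pow_def2 using pow by (simp only: if_False)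
  qed
qed

section \<open>The Magnus action and the lower central series\<close>

text \<open>The map sending \<open>f\<close> to \<open>\<lambda>t. strip_val f (strip v t)\<close>
  is left multiplication by X_v on coefficient functions, so \<open>L_gen\<close> is the Magnus map
  v |-> 1 + X_v written as an action.\<close>

locale magnus_action = group G + commutation_graph adj
  for G :: "('a, 'b) monoid_scheme" (structure) and adj :: "'v \<Rightarrow> 'v \<Rightarrow> bool" +
  fixes V :: "'v set" and \<iota> :: "'v \<Rightarrow> 'a" and L :: "'a \<Rightarrow> ('v list \<Rightarrow> int) \<Rightarrow> 'v list \<Rightarrow> int"
  assumes gen_closed [simp, intro]: "v \<in> V \<Longrightarrow> \<iota> v \<in> carrier G"
    and gen_commute: "v \<in> V \<Longrightarrow> w \<in> V \<Longrightarrow> adj v w \<Longrightarrow> \<iota> v \<otimes> \<iota> w = \<iota> w \<otimes> \<iota> v"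
    and generated: "carrier G \<subseteq> generate G (\<iota> ` V)"
    and L_mult: "g \<in> carrier G \<Longrightarrow> h \<in> carrier G \<Longrightarrow> L (g \<otimes> h) f = L g (L h f)"
    and L_one [simp]: "L \<one> f = f"
    and L_gen: "v \<in> V \<Longrightarrow> L (\<iota> v) f t = f t + strip_val f (strip v t)"
begin

section \<open>Locality and linearity of the action\<close>

lemma carrier_induct [consumes 1, case_names one gen inv mult]:
  assumes "g \<in> carrier G"
    and "P \<one>" "\<And>v. v \<in> V \<Longrightarrow> P (\<iota> v)" "\<And>v. v \<in> V \<Longrightarrow> P (inv \<iota> v)"
    and "\<And>g h. g \<in> carrier G \<Longrightarrow> h \<in> carrier G \<Longrightarrow> P g \<Longrightarrow> P h \<Longrightarrow> P (g \<otimes> h)"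
  shows "P g"
proof -
  have "g \<in> generate G (\<iota> ` V)" using assms(1) generated by blast
  then show ?thesis
  proof (induction rule: generate.induct)
    case (eng h1 h2)
    moreover have "generate G (\<iota> ` V) \<subseteq> carrier G" by (rule generate_incl) auto
    ultimately show ?case using assms(5) by blast
  qed (use assms in auto)
qed

lemma L_inv_cancel [simp]:
  "g \<in> carrier G \<Longrightarrow> L g (L (inv g) f) = f" "g \<in> carrier G \<Longrightarrow> L (inv g) (L g f) = f"
  by (metis L_mult L_one inv_closed r_inv) (metis L_mult L_one inv_closed l_inv)

text \<open>A recursive form of the geometric series for the inverse of 1 + X_v. As
  \<open>strip\<close> shortens lists, it determines the inverse action by induction on the
  length.\<close>

lemma L_inv_gen:
  assumes "v \<in> V"
  shows "L (inv \<iota> v) f t = f t - strip_val (L (inv \<iota> v) f) (strip v t)"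
  using L_gen[OF assms, of "L (inv \<iota> v) f" t] assms by simp

lemma L_cong_on:
  assumes "g \<in> carrier G" "strip_closed B" "\<And>t. t \<in> B \<Longrightarrow> f t = f' t" "t \<in> B"
  shows "L g f t = L g f' t"
  using assms(1,3,4)
proof (induction g arbitrary: f f' t rule: carrier_induct)
  case (gen v)
  then show ?case using strip_closedD[OF assms(2)]
    by (cases "strip v t") (auto simp: L_gen)
next
  case (inv v)
  show ?case using inv(3)
  proof (induction t rule: length_induct)
    case (1 t)
    show ?case
    proof (cases "strip v t")
      case None
      then show ?thesis using inv(1,2) 1(2) L_inv_gen[of v f t] L_inv_gen[of v f' t] by simp
    next
      case (Some u)
      then have "L (inv \<iota> v) f u = L (inv \<iota> v) f' u"
        using 1 strip_length strip_closedD[OF assms(2)] by fastforce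
      then show ?thesis using inv(1,2) 1(2) Some L_inv_gen[of v f t] L_inv_gen[of v f' t] by simp
    qed
  qed
next
  case (mult g h)
  have "L h f s = L h f' s" if "s \<in> B" for s
    by (rule mult.IH(2)) (use mult.prems that in auto)
  then have "L g (L h f) t = L g (L h f') t"
    by (intro mult.IH(1)) (use mult.prems in auto)
  with mult.hyps show ?case by (simp add: L_mult)
qed auto

lemma L_gen_linear:
  "v \<in> V \<Longrightarrow> L (\<iota> v) (\<lambda>t. f t + k * f' t) = (\<lambda>t. L (\<iota> v) f t + k * L (\<iota> v) f' t)"
  by (auto simp: L_gen strip_val_def algebra_simps split: option.splits)

lemma L_linear:
  assumes "g \<in> carrier G"
  shows "L g (\<lambda>t. f t + k * f' t) = (\<lambda>t. L g f t + k * L g f' t)"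
  using assms
proof (induction g arbitrary: f f' rule: carrier_induct)
  case (inv v)
  \<comment> \<open>\<open>L (\<iota> v)\<close> is invertible, so it suffices to compare both sides
    after applying it.\<close>
  have "L (\<iota> v) (\<lambda>t. L (inv \<iota> v) f t + k * L (inv \<iota> v) f' t) = (\<lambda>t. f t + k * f' t)"
    using inv by (subst L_gen_linear) auto
  then show ?case by (metis L_inv_cancel(2) gen_closed inv)
next
  case (mult g h)
  then show ?case by (simp add: L_mult)
qed (auto simp: L_gen_linear)

lemma L_add: "g \<in> carrier G \<Longrightarrow> L g (\<lambda>t. f t + f' t) = (\<lambda>t. L g f t + L g f' t)"
  using L_linear[of g f 1 f'] by simp

lemma L_diff: "g \<in> carrier G \<Longrightarrow> L g (\<lambda>t. f t - f' t) = (\<lambda>t. L g f t - L g f' t)"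
  using L_linear[of g f "-1" f'] by simp

lemma L_zero_on:
  assumes "g \<in> carrier G" "strip_closed B" "\<And>t. t \<in> B \<Longrightarrow> f t = 0" "t \<in> B"
  shows "L g f t = 0"
proof -
  have "L g f t = L g (\<lambda>t. f t - f t) t" by (rule L_cong_on[OF assms(1,2)]) (use assms in auto)
  then show ?thesis using L_diff[OF assms(1), of f f] by simp
qed

section \<open>The degree filtration and the lower central series\<close>

definition vanishes_below :: "nat \<Rightarrow> ('v list \<Rightarrow> int) \<Rightarrow> bool" where
  "vanishes_below m f \<longleftrightarrow> (\<forall>t. length t < m \<longrightarrow> f t = 0)"

lemma vanishes_below_L: "g \<in> carrier G \<Longrightarrow> vanishes_below m f \<Longrightarrow> vanishes_below m (L g f)"
  using L_zero_on[OF _ strip_closed_length, of g m f] by (auto simp: vanishes_below_def)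

lemma vanishes_below_diff:
  "vanishes_below m f \<Longrightarrow> vanishes_below m f' \<Longrightarrow> vanishes_below m (\<lambda>t. f t - f' t)"
  by (auto simp: vanishes_below_def)

lemma vanishes_below_add:
  "vanishes_below m f \<Longrightarrow> vanishes_below m f' \<Longrightarrow> vanishes_below m (\<lambda>t. f t + f' t)"
  by (auto simp: vanishes_below_def)

text \<open>The degree of a function is the least length of a list in its support; \<open>h\<close> belongs to the
  \<open>c\<close>-th subgroup if \<open>L h - 1\<close> raises degrees by at least \<open>c\<close>.\<close>

definition dimension_subgroup :: "nat \<Rightarrow> 'a set" where
  "dimension_subgroup c = {h \<in> carrier G. \<forall>m f. vanishes_below m f \<longrightarrow>
     vanishes_below (m + c) (\<lambda>t. L h f t - f t)}"

lemma dimension_subgroup_carrier: "h \<in> dimension_subgroup c \<Longrightarrow> h \<in> carrier G"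
  by (simp add: dimension_subgroup_def)

lemma dimension_subgroupD:
  "h \<in> dimension_subgroup c \<Longrightarrow> vanishes_below m f \<Longrightarrow> vanishes_below (m + c) (\<lambda>t. L h f t - f t)"
  by (simp add: dimension_subgroup_def)

lemma subgroup_dimension_subgroup: "subgroup (dimension_subgroup c) G"
proof (rule subgroupI)
  show "dimension_subgroup c \<subseteq> carrier G" by (auto simp: dimension_subgroup_def)
  have "\<one> \<in> dimension_subgroup c" by (auto simp: dimension_subgroup_def vanishes_below_def)
  then show "dimension_subgroup c \<noteq> {}" by auto
next
  fix h assume h: "h \<in> dimension_subgroup c"
  note hc = dimension_subgroup_carrier[OF h]
  show "inv h \<in> dimension_subgroup c"
    unfolding dimension_subgroup_def
  proof (intro CollectI conjI allI impI)
    fix m f assume "vanishes_below m f"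
    then have "vanishes_below (m + c) (\<lambda>t. L h (L (inv h) f) t - L (inv h) f t)"
      using hc by (intro dimension_subgroupD[OF h] vanishes_below_L) auto
    then show "vanishes_below (m + c) (\<lambda>t. L (inv h) f t - f t)"
      using hc by (auto simp: vanishes_below_def)
  qed (use hc in auto)
next
  fix h k assume h: "h \<in> dimension_subgroup c" and k: "k \<in> dimension_subgroup c"
  note c = dimension_subgroup_carrier[OF h] dimension_subgroup_carrier[OF k]
  show "h \<otimes> k \<in> dimension_subgroup c"
    unfolding dimension_subgroup_def
  proof (intro CollectI conjI allI impI)
    fix m f assume f: "vanishes_below m f"
    have "vanishes_below (m + c) (\<lambda>t. (L h (L k f) t - L k f t) + (L k f t - f t))"
      using c f by (intro vanishes_below_add dimension_subgroupD[OF h] dimension_subgroupD[OF k] vanishes_below_L)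
    then show "vanishes_below (m + c) (\<lambda>t. L (h \<otimes> k) f t - f t)"
      using c by (simp add: L_mult)
  qed (use c in auto)
qed

lemma gen_dimension_subgroup_1: "v \<in> V \<Longrightarrow> \<iota> v \<in> dimension_subgroup 1"
  by (auto simp: dimension_subgroup_def vanishes_below_def L_gen strip_val_def
      split: option.splits dest: strip_length)

lemma dimension_subgroup_1: "g \<in> carrier G \<Longrightarrow> g \<in> dimension_subgroup 1"
  by (induction g rule: carrier_induct)
    (auto simp del: One_nat_def intro: gen_dimension_subgroup_1
      subgroup.one_closed[OF subgroup_dimension_subgroup]
      subgroup.m_inv_closed[OF subgroup_dimension_subgroup]
      subgroup.m_closed[OF subgroup_dimension_subgroup])

text \<open>With F the image of f under the inverse of kh, the commutator minus 1 sends f to (hk -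
  kh)F = (h - 1)(k - 1)F - (k - 1)(h - 1)F, and each of the two terms raises the degree by at least
  c + 1.\<close>

lemma commutator_dimension_subgroup:
  assumes h: "h \<in> dimension_subgroup c" and kc: "k \<in> carrier G"
  shows "h \<otimes> k \<otimes> inv h \<otimes> inv k \<in> dimension_subgroup (Suc c)"
  unfolding dimension_subgroup_def
proof (intro CollectI conjI allI impI)
  note hc = dimension_subgroup_carrier[OF h] and k = dimension_subgroup_1[OF kc]
  show "h \<otimes> k \<otimes> inv h \<otimes> inv k \<in> carrier G" using hc kc by simp
  fix m f assume "vanishes_below m f"
  define F where "F = L (inv h \<otimes> inv k) f"
  then have F: "vanishes_below m F" using \<open>vanishes_below m f\<close> hc kc by (auto intro: vanishes_below_L)
  have f: "f = L k (L h F)" using hc kc by (simp add: F_def L_mult)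
  have *: "L (h \<otimes> k \<otimes> inv h \<otimes> inv k) f = L h (L k F)"
    using hc kc by (simp add: F_def L_mult m_assoc)
  define a where "a = (\<lambda>t. L k F t - F t)"
  define b where "b = (\<lambda>t. L h F t - F t)"
  have a: "vanishes_below (m + 1) a" unfolding a_def by (rule dimension_subgroupD[OF k F])
  have b: "vanishes_below (m + c) b" unfolding b_def by (rule dimension_subgroupD[OF h F])
  have "(\<lambda>t. L h (L k F) t - f t) = (\<lambda>t. (L h a t - a t) - (L k b t - b t))"
    unfolding f a_def b_def L_diff[OF hc] L_diff[OF kc] by (auto simp: fun_eq_iff)
  moreover have "vanishes_below (m + Suc c) (\<lambda>t. (L h a t - a t) - (L k b t - b t))"
    using vanishes_below_diff[of "m + Suc c" "\<lambda>t. L h a t - a t" "\<lambda>t. L k b t - b t"]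
      dimension_subgroupD[OF h a] dimension_subgroupD[OF k b] by simp
  ultimately show "vanishes_below (m + Suc c) (\<lambda>t. L (h \<otimes> k \<otimes> inv h \<otimes> inv k) f t - f t)"
    unfolding * by simp
qed

lemma lower_central_series_dimension_subgroup:
  "lower_central_series G (Suc c) \<subseteq> dimension_subgroup (Suc c)"
proof (induction c)
  case 0
  then show ?case using dimension_subgroup_1 by auto
next
  case (Suc c)
  then have "(\<Union>h\<in>lower_central_series G (Suc c). \<Union>k\<in>carrier G. {h \<otimes> k \<otimes> inv h \<otimes> inv k})
      \<subseteq> dimension_subgroup (Suc (Suc c))"
    using commutator_dimension_subgroup by blast
  from generate_subgroup_incl[OF this subgroup_dimension_subgroup]
  show ?case by (simp add: commutator_subgroup_def)
qed

lemma L_dimension_subgroup: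
  "h \<in> dimension_subgroup c \<Longrightarrow> length t < c \<Longrightarrow> L h f t = f t"
  using dimension_subgroupD[of h c 0 f] by (auto simp: vanishes_below_def)

section \<open>Magnus coefficients and centralizers\<close>

definition \<delta> :: "'v list \<Rightarrow> int" where
  "\<delta> t = (if t = [] then 1 else 0)"

lemma L_Nil: "g \<in> carrier G \<Longrightarrow> L g f [] = f []"
  using L_dimension_subgroup[OF dimension_subgroup_1, of g "[]" f] by simp

text \<open>\<open>L g \<delta>\<close> is the Magnus expansion of \<open>g\<close>, with
  coefficients indexed by lists. \<open>R x\<close> multiplies by 1 + X_x on the right; it commutes
  with the left action and agrees with \<open>L (\<iota> x)\<close> on \<open>\<delta>\<close>, so
  the expansion of \<open>u \<otimes> \<iota> x\<close> is
  \<open>R x (L u \<delta>)\<close>.\<close>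

definition R :: "'v \<Rightarrow> ('v list \<Rightarrow> int) \<Rightarrow> 'v list \<Rightarrow> int" where
  "R x f t = f t + strip_val f (rstrip x t)"

lemma L_gen_R:
  assumes "v \<in> V"
  shows "L (\<iota> v) (R x f) = R x (L (\<iota> v) f)"
proof
  fix t
  have L_eq: "L (\<iota> v) F = (\<lambda>t. F t + strip_val F (strip v t))" for F
    using assms by (auto simp: L_gen)
  have "strip_val (\<lambda>u. strip_val f (rstrip x u)) (strip v t)
      = strip_val (\<lambda>u. strip_val f (strip v u)) (rstrip x t)"
    using arg_cong[OF strip_rstrip_commute[of v t x], of "strip_val f"] by (simp add: strip_val_bind)
  then show "L (\<iota> v) (R x f) t = R x (L (\<iota> v) f) t"
    by (simp add: L_eq R_def[abs_def] strip_val_add)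
qed

lemma L_R: "g \<in> carrier G \<Longrightarrow> L g (R x f) = R x (L g f)"
proof (induction g arbitrary: f rule: carrier_induct)
  case (inv v)
  then show ?case
    using L_gen_R[of v x "L (inv \<iota> v) f"] by (metis L_inv_cancel gen_closed)
next
  case (mult g h)
  then show ?case by (simp add: L_mult)
qed (auto simp: L_gen_R)

lemma strip_val_\<delta>: "strip_val \<delta> r = (if r = Some [] then 1 else 0)"
  by (cases r) (simp_all add: \<delta>_def)

lemma strip_eq_Some_Nil: "strip x t = Some [] \<longleftrightarrow> t = [x]"
  by (cases t) auto

lemma rstrip_eq_Some_Nil: "rstrip x t = Some [] \<longleftrightarrow> t = [x]"
  by (cases t) (auto split: option.splits)

lemma R_\<delta>: "x \<in> V \<Longrightarrow> R x \<delta> = L (\<iota> x) \<delta>"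
  by (rule ext) (simp add: R_def L_gen strip_val_\<delta> strip_eq_Some_Nil rstrip_eq_Some_Nil)

text \<open>Comparing coefficients at \<open>t @ [x]\<close> moves an \<open>x\<close> that precedes \<open>y\<close> to the end of \<open>t\<close>, until none
  is left that could pass to the front.\<close>

lemma centralizer_support:
  assumes u: "u \<in> carrier G" and x: "x \<in> V"
    and eq: "\<And>t. length t \<le> c \<Longrightarrow> L (\<iota> x \<otimes> u) \<delta> t = L (u \<otimes> \<iota> x) \<delta> t"
    and y: "y \<noteq> x" "\<not> adj x y" and len: "length (p @ y # q) < c"
  shows "L u \<delta> (p @ y # q) = 0"
  using len
proof (induction p arbitrary: q rule: length_induct)
  case (1 p)
  let ?U = "L u \<delta>" and ?t = "p @ y # q"
  have "L (u \<otimes> \<iota> x) \<delta> = R x ?U" using u x by (simp add: L_mult L_R flip: R_\<delta>)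
  \<comment> \<open>The strict bound on the length of \<open>?t\<close> leaves room for the appended
    \<open>x\<close>, which is exactly the letter that \<open>rstrip\<close> removes again.\<close>
  then have "R x ?U (?t @ [x]) = ?U (?t @ [x]) + strip_val ?U (strip x (?t @ [x]))"
    using eq[of "?t @ [x]"] 1 u x by (simp add: L_mult L_gen)
  then have *: "?U ?t = strip_val ?U (strip x (?t @ [x]))"
    unfolding R_def rstrip_snoc by simp
  show ?case
  proof (cases "strip x p")
    case None
    \<comment> \<open>The letter \<open>y\<close> blocks every \<open>x\<close> behind it, including
      the appended one.\<close>
    then have "strip x (?t @ [x]) = None" using y by (simp add: strip_append)
    then show ?thesis using * by simp
  next
    case (Some p')
    then have "strip x (?t @ [x]) = Some (p' @ y # (q @ [x]))" by (simp add: strip_append)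
    moreover have "?U (p' @ y # (q @ [x])) = 0" using 1 strip_length[OF Some] by auto
    ultimately show ?thesis using * by simp
  qed
qed

section \<open>Syllables\<close>

primrec syl_eval :: "('v \<times> int) list \<Rightarrow> 'a" where
  "syl_eval [] = \<one>"
| "syl_eval (p # s) = \<iota> (fst p) [^] snd p \<otimes> syl_eval s"

definition syllables :: "('v \<times> int) list set" where
  "syllables = {s. fst ` set s \<subseteq> V}"

lemma syllables_simps [simp]:
  "[] \<in> syllables" "p # s \<in> syllables \<longleftrightarrow> fst p \<in> V \<and> s \<in> syllables"
  "s @ s' \<in> syllables \<longleftrightarrow> s \<in> syllables \<and> s' \<in> syllables"
  by (auto simp: syllables_def)

lemma syl_eval_closed [simp, intro]: "s \<in> syllables \<Longrightarrow> syl_eval s \<in> carrier G"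
  by (induction s) auto

lemma syl_eval_append:
  "s \<in> syllables \<Longrightarrow> s' \<in> syllables \<Longrightarrow> syl_eval (s @ s') = syl_eval s \<otimes> syl_eval s'"
  by (induction s) (auto simp: m_assoc)

lemma syl_eval_exists: "g \<in> carrier G \<Longrightarrow> \<exists>s\<in>syllables. syl_eval s = g"
proof (induction g rule: carrier_induct)
  case one
  show ?case by (rule bexI[of _ "[]"]) auto
next
  case (gen v)
  then show ?case by (intro bexI[of _ "[(v, 1)]"]) auto
next
  case (inv v)
  then show ?case by (intro bexI[of _ "[(v, -1)]"]) (auto simp: int_pow_neg)
next
  case (mult g h)
  then show ?case by (metis syl_eval_append syllables_simps(3))
qed

lemma syl_eval_commute:
  assumes "y \<in> V" "s \<in> syllables" "\<And>z. z \<in> fst ` set s \<Longrightarrow> adj y z"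
  shows "\<iota> y [^] (e::int) \<otimes> syl_eval s = syl_eval s \<otimes> \<iota> y [^] e"
  using assms(2,3)
proof (induction s)
  case (Cons p s)
  have "\<iota> (fst p) [^] snd p \<otimes> \<iota> y = \<iota> y \<otimes> \<iota> (fst p) [^] snd p"
    using Cons.prems assms(1) gen_commute[of y "fst p"] by (intro commute_int_pow) auto
  then have "\<iota> y [^] e \<otimes> \<iota> (fst p) [^] snd p = \<iota> (fst p) [^] snd p \<otimes> \<iota> y [^] e"
    using Cons.prems assms(1) by (intro commute_int_pow) auto
  then have "\<iota> y [^] e \<otimes> syl_eval (p # s) = \<iota> (fst p) [^] snd p \<otimes> (\<iota> y [^] e \<otimes> syl_eval s)"
    using Cons.prems assms(1) by (simp flip: m_assoc)
  also have "\<iota> y [^] e \<otimes> syl_eval s = syl_eval s \<otimes> \<iota> y [^] e" using Cons by simp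
  finally show ?case using Cons.prems assms(1) by (simp add: m_assoc)
qed (use assms in auto)

section \<open>Square-free coefficients of syllable words\<close>

lemma L_gen_pow_inert:
  assumes "y \<in> V" "strip y t = None"
  shows "L (\<iota> y [^] (e::int)) f t = f t"
proof -
  have step: "L (\<iota> y [^] (1 + e)) f t = L (\<iota> y [^] e) f t" for e :: int
    using assms by (simp add: int_pow_mult L_mult L_gen)
  show ?thesis
  proof (induction e rule: int_induct[where k = 0])
    case (step1 i)
    then show ?case by (simp only: add.commute[of i 1] step)
  next
    case (step2 i)
    then show ?case using step[of "i - 1"] by simp
  qed simp
qed

text \<open>(1 + X_y)^e equals 1 + e X_y up to multiples of X_y^2, and these contribute nothing at a
  square-free list: after one \<open>y\<close> has been stripped, no second one can be.\<close>

lemma L_gen_pow: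
  assumes "y \<in> V" "squarefree_trace t"
  shows "L (\<iota> y [^] (e::int)) f t = f t + e * strip_val f (strip y t)"
proof (cases "strip y t")
  case None
  then show ?thesis using assms by (simp add: L_gen_pow_inert)
next
  case (Some u)
  have step: "L (\<iota> y [^] (1 + e)) f t = L (\<iota> y [^] e) f t + f u" for e :: int
    using assms Some squarefree_strip_twice[OF Some assms(2)]
    by (simp add: int_pow_mult L_mult L_gen L_gen_pow_inert)
  have "L (\<iota> y [^] e) f t = f t + e * f u"
  proof (induction e rule: int_induct[where k = 0])
    case (step1 i)
    then show ?case by (simp only: add.commute[of i 1] step) (simp add: distrib_right)
  next
    case (step2 i)
    then show ?case using step[of "i - 1"] by (simp add: left_diff_distrib)
  qed simp
  with Some show ?thesis by simp
qed

lemma L_syl_eval_inert: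
  "s \<in> syllables \<Longrightarrow> (\<And>z. z \<in> fst ` set s \<Longrightarrow> strip z t = None) \<Longrightarrow> L (syl_eval s) f t = f t"
  by (induction s arbitrary: f) (auto simp: L_mult L_gen_pow_inert)

text \<open>Each syllable contributes at most one letter to a square-free monomial.\<close>

lemma L_syl_eval_long:
  "s \<in> syllables \<Longrightarrow> squarefree_trace t \<Longrightarrow> length s < length t \<Longrightarrow> L (syl_eval s) \<delta> t = 0"
proof (induction s arbitrary: t)
  case (Cons p s)
  have "L (syl_eval s) \<delta> u = 0" if "strip (fst p) t = Some u" for u
    using that Cons strip_length[OF that] strip_squarefree[OF that] by auto
  with Cons show ?case by (cases "strip (fst p) t") (auto simp: L_mult L_gen_pow)
qed (auto simp: \<delta>_def)

text \<open>Every syllable has to contribute its letter: if the first one did not, the remaining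
  syllables would be too few by \<open>L_syl_eval_long\<close>. So only the product of the linear
  terms survives.\<close>

lemma L_syl_eval_coeff:
  "s \<in> syllables \<Longrightarrow> squarefree_trace (map fst s) \<Longrightarrow>
    L (syl_eval s) \<delta> (map fst s) = prod_list (map snd s)"
proof (induction s)
  case (Cons p s)
  then have "L (syl_eval s) \<delta> (fst p # map fst s) = 0" by (intro L_syl_eval_long) auto
  with Cons show ?case by (simp add: L_mult L_gen_pow)
qed (auto simp: \<delta>_def)

section \<open>Moving syllables and shortest words\<close>

lemma syl_eval_strip:
  assumes "s \<in> syllables" "strip y (map fst s) = Some u"
  obtains e s' where "s' \<in> syllables" "map fst s' = u" "(y, e) \<in> set s"
    "syl_eval s = \<iota> y [^] e \<otimes> syl_eval s'"
proof -
  have "\<exists>e s'. s' \<in> syllables \<and> map fst s' = u \<and> (y, e) \<in> set s \<and> syl_eval s = \<iota> y [^] e \<otimes> syl_eval s'"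
    using assms
  proof (induction s arbitrary: u)
    case (Cons p s)
    show ?case
    proof (cases "fst p = y")
      case True
      then show ?thesis using Cons.prems by (intro exI[of _ "snd p"] exI[of _ s]) auto
    next
      case False
      then obtain u' where u': "adj y (fst p)" "strip y (map fst s) = Some u'" "u = fst p # u'"
        using Cons.prems by (auto split: if_splits)
      with Cons obtain e s' where s': "s' \<in> syllables" "map fst s' = u'" "(y, e) \<in> set s"
        "syl_eval s = \<iota> y [^] e \<otimes> syl_eval s'" by auto
      have y: "y \<in> V" using Cons.prems(1) s'(3) by (force simp: syllables_def)
      have "\<iota> y [^] e \<otimes> syl_eval [p] = syl_eval [p] \<otimes> \<iota> y [^] e"
        by (rule syl_eval_commute) (use u' y Cons.prems in auto)
      then have "syl_eval (p # s) = \<iota> y [^] e \<otimes> syl_eval (p # s')"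
        using Cons.prems y s' by (simp flip: m_assoc)
      then show ?thesis using s' u' Cons.prems by (intro exI[of _ e] exI[of _ "p # s'"]) auto
    qed
  qed auto
  then show ?thesis using that by blast
qed

lemma syl_eval_rstrip:
  assumes "s \<in> syllables" "rstrip y (map fst s) = Some u"
  obtains e s' where "y \<in> V" "s' \<in> syllables" "map fst s' = u" "length s = Suc (length s')"
    "syl_eval s = syl_eval s' \<otimes> \<iota> y [^] (e::int)"
proof -
  have "\<exists>e s'. y \<in> V \<and> s' \<in> syllables \<and> map fst s' = u \<and> length s = Suc (length s') \<and>
    syl_eval s = syl_eval s' \<otimes> \<iota> y [^] (e::int)"
    using assms
  proof (induction s arbitrary: u)
    case (Cons p s)
    show ?case
    proof (cases "rstrip y (map fst s)")
      case None
      then have p: "fst p = y" "\<And>z. z \<in> fst ` set s \<Longrightarrow> adj y z" "u = map fst s"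
        using Cons.prems by (auto split: if_splits)
      then have "\<iota> y [^] snd p \<otimes> syl_eval s = syl_eval s \<otimes> \<iota> y [^] snd p"
        using Cons.prems by (intro syl_eval_commute) auto
      then show ?thesis using Cons.prems p by (intro exI[of _ "snd p"] exI[of _ s]) auto
    next
      case (Some u')
      with Cons obtain e s' where s': "y \<in> V" "s' \<in> syllables" "map fst s' = u'"
        "length s = Suc (length s')" "syl_eval s = syl_eval s' \<otimes> \<iota> y [^] (e::int)" by auto
      then show ?thesis using Cons.prems Some
        by (intro exI[of _ e] exI[of _ "p # s'"]) (auto simp: m_assoc)
    qed
  qed auto
  then show ?thesis using that by blast
qed

text \<open>Minimality is over all words for the same group element, not over rewritings of
  \<open>s\<close>; \<open>shorten\<close> yields the combinatorial consequences.\<close>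

definition reduced :: "('v \<times> int) list \<Rightarrow> bool" where
  "reduced s \<longleftrightarrow> s \<in> syllables \<and>
     (\<forall>s'\<in>syllables. syl_eval s' = syl_eval s \<longrightarrow> length s \<le> length s')"

text \<open>A syllable with exponent 0 is dropped, and two syllables at one vertex that can be
  brought together are merged.\<close>

lemma shorten:
  assumes "s \<in> syllables" "\<not> (squarefree_trace (map fst s) \<and> 0 \<notin> snd ` set s)"
  shows "\<exists>s'\<in>syllables. syl_eval s' = syl_eval s \<and> length s' < length s"
  using assms
proof (induction s)
  case (Cons p s)
  consider "\<not> (squarefree_trace (map fst s) \<and> 0 \<notin> snd ` set s)" | "snd p = 0"
    | u where "strip (fst p) (map fst s) = Some u"
    using Cons.prems by auto
  then show ?case
  proof cases
    case 1
    then obtain s' where "s' \<in> syllables" "syl_eval s' = syl_eval s" "length s' < length s"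
      using Cons by auto
    then show ?thesis using Cons.prems by (intro bexI[of _ "p # s'"]) auto
  next
    case 2
    then show ?thesis using Cons.prems by (intro bexI[of _ s]) auto
  next
    case 3
    have "s \<in> syllables" using Cons.prems by simp
    from syl_eval_strip[OF this 3] obtain e s' where s': "s' \<in> syllables" "map fst s' = u"
      "(fst p, e) \<in> set s" "syl_eval s = \<iota> (fst p) [^] e \<otimes> syl_eval s'" .
    have "length (map fst s) = Suc (length s')" using strip_length[OF 3] s'(2) by auto
    moreover have "syl_eval ((fst p, snd p + e) # s') = syl_eval (p # s)"
      using s'(1) Cons.prems(1) by (simp add: s'(4) int_pow_mult m_assoc)
    ultimately show ?thesis using s'(1) Cons.prems(1)
      by (intro bexI[of _ "(fst p, snd p + e) # s'"]) simp_all
  qed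
qed auto

lemma reduced_squarefree: "reduced s \<Longrightarrow> squarefree_trace (map fst s)"
  and reduced_nonzero: "reduced s \<Longrightarrow> 0 \<notin> snd ` set s"
  using shorten[of s] by (force simp: reduced_def)+

text \<open>The coefficient is the product of the nonzero exponents. This is how the Magnus map
  detects a nonempty shortest word.\<close>

lemma reduced_L_nonzero:
  "reduced s \<Longrightarrow> L (syl_eval s) \<delta> (map fst s) \<noteq> 0"
  using L_syl_eval_coeff[of s] reduced_squarefree[of s] reduced_nonzero[of s]
  by (auto simp: reduced_def prod_list_zero_iff)

section \<open>Equality of actions up to a given degree\<close>

definition agree :: "nat \<Rightarrow> 'a \<Rightarrow> 'a \<Rightarrow> bool" where
  "agree c g h \<longleftrightarrow> (\<forall>f t. length t \<le> c \<longrightarrow> L g f t = L h f t)"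

lemma agree_mult_left:
  assumes "agree c g h" "k \<in> carrier G" "g \<in> carrier G" "h \<in> carrier G"
  shows "agree c (k \<otimes> g) (k \<otimes> h)"
  unfolding agree_def
proof (intro allI impI)
  fix f and t :: "'v list" assume "length t \<le> c"
  then have "L k (L g f) t = L k (L h f) t"
    using assms by (intro L_cong_on[OF _ strip_closed_length[of "Suc c"]]) (auto simp: agree_def)
  then show "L (k \<otimes> g) f t = L (k \<otimes> h) f t" using assms by (simp add: L_mult)
qed

lemma agree_mult_right:
  "agree c g h \<Longrightarrow> k \<in> carrier G \<Longrightarrow> g \<in> carrier G \<Longrightarrow> h \<in> carrier G \<Longrightarrow> agree c (g \<otimes> k) (h \<otimes> k)"
  by (simp add: agree_def L_mult)

lemma agree_trans [trans]: "agree c g h \<Longrightarrow> agree c h k \<Longrightarrow> agree c g k"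
  by (simp add: agree_def)

lemma agree_conj:
  assumes "agree c g h" "k \<in> carrier G" "g \<in> carrier G" "h \<in> carrier G"
  shows "agree c (k \<otimes> g \<otimes> inv k) (k \<otimes> h \<otimes> inv k)"
  using assms by (intro agree_mult_right agree_mult_left) auto

text \<open>The expression is the coefficient of (w - 1)^2 at \<open>t\<close>. Up to degree
  \<open>c\<close> this square is the conjugate of X_x^2 by g. Applying X_x^2 gives a function that
  is 0 on square-free lists, and the action of g preserves this, since these lists are
  strip-closed.\<close>

lemma agree_square_zero:
  assumes "agree c w (g \<otimes> \<iota> x \<otimes> inv g)" "w \<in> carrier G" "g \<in> carrier G" "x \<in> V"
    and t: "squarefree_trace t" "length t \<le> c"
  shows "L (w \<otimes> w) \<delta> t - 2 * L w \<delta> t + \<delta> t = 0"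
proof -
  let ?v = "g \<otimes> \<iota> x \<otimes> inv g"
  have v: "?v \<in> carrier G" using assms by simp
  have "agree c (w \<otimes> w) (?v \<otimes> ?v)"
    using agree_mult_left[OF assms(1) assms(2) assms(2) v] agree_mult_right[OF assms(1) v assms(2) v]
    by (rule agree_trans)
  moreover have "?v \<otimes> ?v = g \<otimes> \<iota> x \<otimes> \<iota> x \<otimes> inv g"
    using assms by (simp add: m_assoc)
  ultimately have w: "L (w \<otimes> w) \<delta> t = L (g \<otimes> \<iota> x \<otimes> \<iota> x \<otimes> inv g) \<delta> t" "L w \<delta> t = L ?v \<delta> t"
    using assms by (auto simp: agree_def)
  define f where "f = L (inv g) \<delta>"
  \<comment> \<open>This is X_x^2 applied to \<open>f\<close>, expanded as (1 + X_x)^2 - 2(1 + X_x)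
    + 1.\<close>
  define D where "D = (\<lambda>t. (L (\<iota> x) (L (\<iota> x) f) t + (-2) * L (\<iota> x) f t) + f t)"
  have "L g D t = 0"
  proof (rule L_zero_on[OF _ strip_closed_squarefree])
    fix t assume t: "t \<in> Collect squarefree_trace"
    show "D t = 0" unfolding D_def using \<open>x \<in> V\<close> t squarefree_strip_twice[of x t]
      by (cases "strip x t") (auto simp: L_gen)
  qed (use t assms in auto)
  moreover have "L g D = (\<lambda>t. (L g (L (\<iota> x) (L (\<iota> x) f)) t + (-2) * L g (L (\<iota> x) f) t) + L g f t)"
    unfolding D_def using assms by (subst L_add, simp, subst L_linear) auto
  ultimately show ?thesis unfolding w using assms by (simp add: f_def L_mult)
qed

text \<open>A conjugate of x differs from x by a commutator, which acts trivially at lists of length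
  less than 2.\<close>

lemma agree_degree_one:
  assumes "agree 1 w (g \<otimes> \<iota> x \<otimes> inv g)" "g \<in> carrier G" "x \<in> V"
  shows "L w \<delta> [y] = (if y = x then 1 else 0)"
proof -
  have "g \<otimes> \<iota> x \<otimes> inv g \<otimes> inv \<iota> x \<in> dimension_subgroup (Suc 1)"
    using assms by (intro commutator_dimension_subgroup dimension_subgroup_1) auto
  then have "L (g \<otimes> \<iota> x \<otimes> inv g \<otimes> inv \<iota> x) (L (\<iota> x) \<delta>) [y] = L (\<iota> x) \<delta> [y]"
    by (rule L_dimension_subgroup) simp
  then have "L (g \<otimes> \<iota> x \<otimes> inv g) \<delta> [y] = L (\<iota> x) \<delta> [y]"
    using assms by (simp add: L_mult)
  then show ?thesis using assms by (auto simp: agree_def L_gen \<delta>_def)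
qed

section \<open>Pro-nilpotently inner families are inner\<close>

text \<open>A shortest word among those for all conjugates of \<open>a\<close> admits no shortening
  by cyclic merges; the square-free coefficients of (w - 1)^2 then leave only the word x.\<close>

lemma pro_conjugate_generator:
  assumes x: "x \<in> V" and a: "a \<in> carrier G"
    and pro: "\<And>c. \<exists>g\<in>carrier G. agree c a (g \<otimes> \<iota> x \<otimes> inv g)"
  shows "\<exists>h\<in>carrier G. a = h \<otimes> \<iota> x \<otimes> inv h"
proof -
  define P where "P s \<longleftrightarrow> s \<in> syllables \<and> (\<exists>h\<in>carrier G. syl_eval s = h \<otimes> a \<otimes> inv h)" for s
  obtain s0 where "P s0" using syl_eval_exists[OF a] a unfolding P_def by (metis l_one inv_one one_closed r_one)
  from ex_has_least_nat[where P = P and m = length, OF this]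
  obtain s where s: "P s" "\<And>s'. P s' \<Longrightarrow> length s \<le> length s'" by auto
  define w where "w = syl_eval s"
  obtain h where h: "h \<in> carrier G" "w = h \<otimes> a \<otimes> inv h" using s(1) by (auto simp: P_def w_def)
  have w: "w \<in> carrier G" using h a by simp
  have sV: "s \<in> syllables" using s(1) by (simp add: P_def)
  have red: "reduced s1" if "s1 \<in> syllables" "syl_eval s1 = w" "length s1 = length s" for s1
    using s that h by (auto simp: reduced_def P_def)
  have wpro: "\<exists>g\<in>carrier G. agree c w (g \<otimes> \<iota> x \<otimes> inv g)" for c
  proof -
    obtain g where g: "g \<in> carrier G" "agree c a (g \<otimes> \<iota> x \<otimes> inv g)" using pro by blast
    have "agree c w (h \<otimes> (g \<otimes> \<iota> x \<otimes> inv g) \<otimes> inv h)"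
      unfolding h(2) using g h(1) a x by (intro agree_conj) auto
    also have "h \<otimes> (g \<otimes> \<iota> x \<otimes> inv g) \<otimes> inv h = (h \<otimes> g) \<otimes> \<iota> x \<otimes> inv (h \<otimes> g)"
      using g h x by (simp add: m_assoc inv_mult_group)
    finally show ?thesis using g h by blast
  qed
  have deg1: "L w \<delta> [y] = (if y = x then 1 else 0)" for y
    using wpro[of 1] agree_degree_one x by blast
  have square: "L (w \<otimes> w) \<delta> t - 2 * L w \<delta> t + \<delta> t = 0" if "squarefree_trace t" for t
    using wpro[of "length t"] agree_square_zero[OF _ w _ x that] by blast
  \<comment> \<open>A vertex that is free at both ends of a shortest word is x, with exponent 1, and
    the rest lies in its link. The claim is for any word \<open>s1\<close> because it serves for
    \<open>s\<close> and for the rearranged word \<open>(x, 1) # s'\<close>.\<close>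
  have claim: "y = x \<and> (\<exists>s'. s' \<in> syllables \<and> w = \<iota> x \<otimes> syl_eval s' \<and> Suc (length s') = length s \<and>
      (\<forall>z\<in>fst ` set s'. adj x z))"
    if s1: "s1 \<in> syllables" "syl_eval s1 = w" "length s1 = length s"
      and rs: "rstrip y (map fst s1) \<noteq> None" and ls: "strip y (map fst s1) \<noteq> None" for y s1
  proof -
    obtain u where u: "strip y (map fst s1) = Some u" using ls by blast
    from syl_eval_strip[OF s1(1) u] obtain e s' where s': "s' \<in> syllables" "map fst s' = u"
      "(y, e) \<in> set s1" "syl_eval s1 = \<iota> y [^] e \<otimes> syl_eval s'" .
    have yV: "y \<in> V" using s1(1) s'(3) by (force simp: syllables_def)
    have len: "Suc (length s') = length s" using strip_length[OF u] s'(2) s1(3) by auto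
    have e: "e \<noteq> 0" using reduced_nonzero[OF red[OF s1]] s'(3) by (force simp: image_iff)
    \<comment> \<open>Otherwise \<open>y\<close> carries two distinct syllables, at the two ends,
      and conjugation by the last one merges them into a shorter word.\<close>
    have "rstrip y u = None"
    proof (rule ccontr)
      assume "rstrip y u \<noteq> None"
      then obtain u' where "rstrip y (map fst s') = Some u'" using s'(2) by auto
      from syl_eval_rstrip[OF s'(1) this] obtain e' s'' where s'': "s'' \<in> syllables"
        "length s' = Suc (length s'')" "syl_eval s' = syl_eval s'' \<otimes> \<iota> y [^] (e'::int)" .
      define k where "k = \<iota> y [^] e'"
      have k: "k \<in> carrier G" using yV by (simp add: k_def)
      have "syl_eval ((y, e' + e) # s'') = k \<otimes> w \<otimes> inv k"
        using s1(2) s'(4) s''(1,3) yV k by (simp add: int_pow_mult m_assoc flip: k_def s1(2))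
      also have "\<dots> = (k \<otimes> h) \<otimes> a \<otimes> inv (k \<otimes> h)"
        using h k a by (simp add: m_assoc inv_mult_group)
      finally have "P ((y, e' + e) # s'')"
        using s''(1) yV k h(1) unfolding P_def by (intro conjI bexI[of _ "k \<otimes> h"]) auto
      from s(2)[OF this] show False using s''(2) len by simp
    qed
    then have adj: "adj y z" if "z \<in> set u" for z
      using strip_rstrip_single[OF u rs _ that] by blast
    then have "y \<notin> set u" using adj_irrefl by blast
    \<comment> \<open>As \<open>y\<close> occurs only once, its exponent is the coefficient of
      \<open>w\<close> at \<open>[y]\<close>, which \<open>deg1\<close> prescribes.\<close>
    then have "L (syl_eval s') \<delta> [y] = 0"
      using s'(1,2) L_syl_eval_inert[of s' "[y]" \<delta>] by (force simp: \<delta>_def split: if_splits)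
    then have "L w \<delta> [y] = e"
      unfolding s1(2)[symmetric] s'(4) using yV s'(1) by (simp add: L_mult L_gen_pow L_Nil \<delta>_def)
    then have "y = x" "e = 1" using e deg1[of y] by (auto split: if_splits)
    moreover have "\<forall>z\<in>fst ` set s'. adj y z"
      using adj unfolding s'(2)[symmetric] set_map by blast
    ultimately show ?thesis using s' s1 len x by (intro conjI exI[of _ s']) simp_all
  qed
  have "w = \<iota> x"
  proof (cases "squarefree_trace (map fst s @ map fst s)")
    \<comment> \<open>This case is contradictory: at \<open>?t\<close>, longer than
      \<open>s\<close>, both \<open>w\<close> and 1 have coefficient 0, while that of w^2 is the
      square of the product of the exponents.\<close>
    case True
    let ?t = "map fst s @ map fst s"
    have "s \<noteq> []" using deg1[of x] by (auto simp: w_def \<delta>_def)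
    then have "L w \<delta> ?t = 0" "\<delta> ?t = 0"
      unfolding w_def using sV True by (auto intro!: L_syl_eval_long simp: \<delta>_def)
    moreover have "L (w \<otimes> w) \<delta> ?t \<noteq> 0"
      using L_syl_eval_coeff[of "s @ s"] True sV reduced_nonzero[OF red[OF sV]]
      by (auto simp: syl_eval_append w_def prod_list_zero_iff)
    ultimately show ?thesis using square[OF True] by simp
  next
    case False
    have "squarefree_trace (map fst s)" using red[OF sV] w_def reduced_squarefree by simp
    then obtain y where "rstrip y (map fst s) \<noteq> None" "strip y (map fst s) \<noteq> None"
      using False squarefree_append by blast
    from claim[OF sV _ _ this] obtain s' where s': "s' \<in> syllables" "w = \<iota> x \<otimes> syl_eval s'"
      "Suc (length s') = length s" "\<And>z. z \<in> fst ` set s' \<Longrightarrow> adj x z" using w_def by auto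
    have s1: "(x, 1) # s' \<in> syllables" "syl_eval ((x, 1) # s') = w" "length ((x, 1) # s') = length s"
      using s' x by auto
    let ?t = "map fst s'"
    have xt: "x \<notin> set ?t" using s'(4) by fastforce
    have sf: "squarefree_trace ?t" "0 \<notin> snd ` set s'"
      using reduced_squarefree[OF red[OF s1]] reduced_nonzero[OF red[OF s1]] by auto
    \<comment> \<open>A vertex free at both ends of \<open>s'\<close> commutes with x, so it is free
      at both ends of \<open>(x, 1) # s'\<close> too, and the claim would identify it with
      x.\<close>
    have tt: "squarefree_trace (?t @ ?t)"
    proof (rule ccontr)
      assume "\<not> squarefree_trace (?t @ ?t)"
      then obtain y where y: "rstrip y ?t \<noteq> None" "strip y ?t \<noteq> None"
        using sf squarefree_append by blast
      then have "y \<in> set ?t" using strip_None[of y ?t] by argo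
      with s'(4) have "adj y x" "y \<noteq> x" using adj_sym by fastforce+
      then have "rstrip y (map fst ((x, 1) # s')) \<noteq> None" "strip y (map fst ((x, 1) # s')) \<noteq> None"
        using y by (auto split: option.splits)
      from claim[OF s1 this] \<open>y \<noteq> x\<close> show False by blast
    qed
    \<comment> \<open>As x does not occur in \<open>?t @ ?t\<close>, the factors x act trivially at
      that list, and the argument of the first case applies to \<open>s'\<close> in place of
      \<open>s\<close>.\<close>
    have "s' = []"
    proof (rule ccontr)
      assume ne: "s' \<noteq> []"
      have comm: "syl_eval s' \<otimes> \<iota> x = \<iota> x \<otimes> syl_eval s'"
        using syl_eval_commute[OF x s'(1) s'(4), of 1] x by simp
      have "w \<otimes> w = \<iota> x \<otimes> (syl_eval s' \<otimes> \<iota> x) \<otimes> syl_eval s'"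
        unfolding s'(2) using x s'(1) by (simp add: m_assoc)
      also have "\<dots> = \<iota> x \<otimes> (\<iota> x \<otimes> syl_eval (s' @ s'))"
        unfolding comm using x s'(1) by (simp add: m_assoc syl_eval_append)
      finally have ww: "w \<otimes> w = \<iota> x \<otimes> (\<iota> x \<otimes> syl_eval (s' @ s'))" .
      have inert: "L (\<iota> x) f (?t @ ?t) = f (?t @ ?t)" for f
        using x xt by (simp add: L_gen strip_None)
      have "L w \<delta> (?t @ ?t) = 0" "\<delta> (?t @ ?t) = 0"
        unfolding s'(2) using s'(1) x ne tt by (auto simp: L_mult inert \<delta>_def intro!: L_syl_eval_long)
      moreover have "L (w \<otimes> w) \<delta> (?t @ ?t) \<noteq> 0"
        unfolding ww using L_syl_eval_coeff[of "s' @ s'"] tt s'(1) sf(2) x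
        by (auto simp: L_mult inert prod_list_zero_iff simp del: syl_eval.simps)
      ultimately show False using square[OF tt] by simp
    qed
    then show ?thesis using s'(2) x by simp
  qed
  moreover have "a = inv h \<otimes> w \<otimes> inv (inv h)" using h a by (simp add: m_assoc)
  ultimately show ?thesis using h(1) by (intro bexI[of _ "inv h"]) auto
qed

section \<open>Aligning the conjugators\<close>

lemma gen_pow_commute:
  "x \<in> V \<Longrightarrow> y \<in> V \<Longrightarrow> y = x \<or> adj x y \<Longrightarrow> \<iota> y [^] (e::int) \<otimes> \<iota> x = \<iota> x \<otimes> \<iota> y [^] e"
  using gen_commute[of x y] by (intro commute_int_pow) auto

lemma conj_absorb:
  assumes "a \<in> carrier G" "k \<in> carrier G" "x \<in> carrier G" "k \<otimes> x = x \<otimes> k"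
  shows "(a \<otimes> k) \<otimes> x \<otimes> inv (a \<otimes> k) = a \<otimes> x \<otimes> inv a"
proof -
  have "(a \<otimes> k) \<otimes> x \<otimes> inv (a \<otimes> k) = a \<otimes> (k \<otimes> x) \<otimes> (inv k \<otimes> inv a)"
    using assms(1-3) by (simp add: m_assoc inv_mult_group)
  also have "\<dots> = a \<otimes> x \<otimes> inv a" unfolding assms(4) using assms(1-3) by (simp add: m_assoc)
  finally show ?thesis .
qed

text \<open>Multiplying by \<open>inv g\<close> on the left and \<open>k\<close> on the right turns
  agreement of two conjugates into commutation up to degree \<open>c\<close>.\<close>

lemma agree_conj_swap:
  assumes "agree c (g \<otimes> x \<otimes> inv g) (k \<otimes> x \<otimes> inv k)"
    and "g \<in> carrier G" "k \<in> carrier G" "x \<in> carrier G"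
  shows "agree c (x \<otimes> (inv g \<otimes> k)) ((inv g \<otimes> k) \<otimes> x)"
proof -
  have "agree c (inv g \<otimes> (g \<otimes> x \<otimes> inv g) \<otimes> k) (inv g \<otimes> (k \<otimes> x \<otimes> inv k) \<otimes> k)"
    using assms by (intro agree_mult_right agree_mult_left) auto
  then show ?thesis using assms by (simp add: m_assoc)
qed

theorem pro_inner:
  assumes "finite V" and W: "\<And>x. x \<in> V \<Longrightarrow> W x \<in> carrier G"
    and pro: "\<And>c. \<exists>g\<in>carrier G. \<forall>x\<in>V. agree c (W x) (g \<otimes> \<iota> x \<otimes> inv g)"
  shows "\<exists>g\<in>carrier G. \<forall>x\<in>V. W x = g \<otimes> \<iota> x \<otimes> inv g"
proof -
  have "\<exists>g\<in>carrier G. \<forall>x\<in>S. W x = g \<otimes> \<iota> x \<otimes> inv g" if "finite S" "S \<subseteq> V" for S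
    using that
  proof (induction S)
    case empty
    then show ?case by blast
  next
    case (insert x S)
    then have x: "x \<in> V" and S: "\<And>v. v \<in> S \<Longrightarrow> v \<in> V" by auto
    from insert obtain g0 where g0: "g0 \<in> carrier G" "\<forall>v\<in>S. W v = g0 \<otimes> \<iota> v \<otimes> inv g0" by auto
    obtain h where h: "h \<in> carrier G" "W x = h \<otimes> \<iota> x \<otimes> inv h"
      using pro_conjugate_generator[OF x W[OF x]] pro x by meson
    obtain r0 where r0: "r0 \<in> syllables" "syl_eval r0 = inv g0 \<otimes> h"
      using syl_eval_exists g0 h by (meson inv_closed m_closed)
    \<comment> \<open>\<open>r\<close> measures how far a conjugator \<open>g\<close> for
      \<open>S\<close> is from one for x. The minimum runs over all pairs, so that syllables may be
      shifted from \<open>r\<close> into \<open>g\<close>.\<close>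
    define P where "P g r \<longleftrightarrow> g \<in> carrier G \<and> r \<in> syllables \<and> (\<forall>v\<in>S. W v = g \<otimes> \<iota> v \<otimes> inv g) \<and>
      W x = (g \<otimes> syl_eval r) \<otimes> \<iota> x \<otimes> inv (g \<otimes> syl_eval r)" for g r
    have "P g0 r0" unfolding P_def r0(2) using g0 h r0(1) by simp
    then have "\<exists>g. P g r0" ..
    from ex_has_least_nat[where P = "\<lambda>r. \<exists>g. P g r" and m = length, OF this]
    obtain g r where gr: "P g r" and min: "\<And>g' r'. P g' r' \<Longrightarrow> length r \<le> length r'" by blast
    have g: "g \<in> carrier G" and r: "r \<in> syllables"
      and WS: "\<And>v. v \<in> S \<Longrightarrow> W v = g \<otimes> \<iota> v \<otimes> inv g"
      and Wx: "W x = (g \<otimes> syl_eval r) \<otimes> \<iota> x \<otimes> inv (g \<otimes> syl_eval r)"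
      using gr by (auto simp: P_def)
    have red: "reduced r"
      unfolding reduced_def
    proof (intro conjI ballI impI)
      fix r' assume r': "r' \<in> syllables" "syl_eval r' = syl_eval r"
      then have "P g r'" using gr by (simp add: P_def)
      then show "length r \<le> length r'" by (rule min)
    qed (rule r)
    have "r = []"
    proof (cases r)
      case (Cons p r')
      let ?t = "map fst r"
      \<comment> \<open>One more than the length of \<open>r\<close>, because \<open>B\<close> and
        \<open>centralizer_support\<close> use strict bounds.\<close>
      define c where "c = Suc (length ?t)"
      obtain k where k: "k \<in> carrier G" "\<And>v. v \<in> V \<Longrightarrow> agree c (W v) (k \<otimes> \<iota> v \<otimes> inv k)"
        using pro by blast
      define u where "u = inv g \<otimes> k"
      define u' where "u' = inv (g \<otimes> syl_eval r) \<otimes> k"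
      have u: "u \<in> carrier G" "u' \<in> carrier G" using g k r by (auto simp: u_def u'_def)
      have uu': "u = syl_eval r \<otimes> u'"
        using g k r by (simp add: u_def u'_def inv_mult_group m_assoc)
      have agS: "agree c (\<iota> v \<otimes> u) (u \<otimes> \<iota> v)" if "v \<in> S" for v
        unfolding u_def using k(2)[OF S[OF that]] WS[OF that] g k S[OF that]
        by (intro agree_conj_swap) auto
      have agx: "agree c (\<iota> x \<otimes> u') (u' \<otimes> \<iota> x)"
        unfolding u'_def using k(2)[OF x] Wx g k r x by (intro agree_conj_swap) auto
      \<comment> \<open>The lists in which no letter from the star of x can be moved to the end. A
        nonempty one ends in a letter outside the star, so \<open>u'\<close>, which commutes with x
        up to degree \<open>c\<close>, has coefficient 0 there.\<close>
      define B where "B = {b. length b < c} \<inter> {b. \<forall>y\<in>{y. y = x \<or> adj x y}. rstrip y b = None}"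
      have B: "strip_closed B"
        unfolding B_def by (intro strip_closed_Int strip_closed_length strip_closed_rstrip)
      have "L u' \<delta> b = \<delta> b" if b: "b \<in> B" for b
      proof (cases b rule: rev_cases)
        case Nil
        then show ?thesis using u by (simp add: L_Nil)
      next
        case (snoc b' y)
        then have "y \<noteq> x" "\<not> adj x y" using b rstrip_snoc[of y b'] by (auto simp: B_def)
        moreover have "length (b' @ [y]) < c" using b snoc by (simp add: B_def)
        ultimately have "L u' \<delta> (b' @ [y]) = 0"
          using agx by (intro centralizer_support[OF u(2) x]) (auto simp: agree_def)
        with snoc show ?thesis by (simp add: \<delta>_def)
      qed
      moreover have "?t \<in> B"
      proof -
        have "rstrip y ?t = None" if y: "y = x \<or> adj x y" for y
        proof (rule ccontr)
          assume "rstrip y ?t \<noteq> None"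
          then obtain t' where "rstrip y ?t = Some t'" by blast
          from syl_eval_rstrip[OF r this] obtain e s' where s': "y \<in> V" "s' \<in> syllables"
            "length r = Suc (length s')" "syl_eval r = syl_eval s' \<otimes> \<iota> y [^] (e::int)" .
          have "W x = ((g \<otimes> syl_eval s') \<otimes> \<iota> y [^] e) \<otimes> \<iota> x \<otimes> inv ((g \<otimes> syl_eval s') \<otimes> \<iota> y [^] e)"
            unfolding Wx s'(4) using g s' by (simp add: m_assoc)
          also have "\<dots> = (g \<otimes> syl_eval s') \<otimes> \<iota> x \<otimes> inv (g \<otimes> syl_eval s')"
            using g s' x y by (intro conj_absorb gen_pow_commute) auto
          finally have "P g s'" using g s' WS by (simp add: P_def)
          from min[OF this] show False using s'(3) by simp
        qed
        then show ?thesis by (simp add: B_def c_def)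
      qed
      ultimately have "L (syl_eval r) (L u' \<delta>) ?t = L (syl_eval r) \<delta> ?t"
        using r by (intro L_cong_on[OF _ B]) auto
      \<comment> \<open>On \<open>B\<close> the function \<open>L u' \<delta>\<close> equals
        \<open>\<delta>\<close>, so at \<open>?t\<close> the coefficient of \<open>u\<close> is that
        of the reduced word \<open>r\<close>.\<close>
      then have nz: "L u \<delta> ?t \<noteq> 0"
        using reduced_L_nonzero[OF red] r u unfolding uu' by (simp add: L_mult)
      let ?y = "fst p"
      have yV: "?y \<in> V" and r': "r' \<in> syllables" using r Cons by auto
      \<comment> \<open>\<open>u\<close> commutes with \<open>v\<close> up to degree
        \<open>c\<close>, so its nonzero coefficient at \<open>?t\<close> forces the first letter of
        \<open>?t\<close> into the star of \<open>v\<close>.\<close>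
      have yS: "?y = v \<or> adj v ?y" if "v \<in> S" for v
      proof (rule ccontr)
        assume "\<not> (?y = v \<or> adj v ?y)"
        then have "L u \<delta> ([] @ ?y # map fst r') = 0"
          using agS[OF that] Cons
          by (intro centralizer_support[OF u(1) S[OF that]]) (auto simp: agree_def c_def)
        with nz Cons show False by simp
      qed
      let ?k = "\<iota> ?y [^] snd p"
      \<comment> \<open>The first syllable of \<open>r\<close> thus commutes with the generators in
        \<open>S\<close> and can move into \<open>g\<close>, leaving the shorter word
        \<open>r'\<close>.\<close>
      have "W v = (g \<otimes> ?k) \<otimes> \<iota> v \<otimes> inv (g \<otimes> ?k)" if "v \<in> S" for v
        unfolding WS[OF that] using g yV yS[OF that] S[OF that]
        by (intro conj_absorb[symmetric] gen_pow_commute) auto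
      moreover have "g \<otimes> ?k \<otimes> syl_eval r' = g \<otimes> syl_eval r" using Cons g yV r' by (simp add: m_assoc)
      ultimately have "P (g \<otimes> ?k) r'" unfolding P_def using g yV r' Wx by simp
      from min[OF this] show ?thesis using Cons by simp
    qed simp
    then show ?case using g WS Wx by (intro bexI[of _ g]) auto
  qed
  then show ?thesis using assms(1) by blast
qed

end

section \<open>Right-angled Artin groups\<close>

lemma words_simps [simp]:
  "[] \<in> words X" "p # u \<in> words X \<longleftrightarrow> fst p \<in> X \<and> u \<in> words X"
  "u @ v \<in> words X \<longleftrightarrow> u \<in> words X \<and> v \<in> words X"
  by (auto simp: words_def mem_Times_iff)

lemma pres_rel_words: "(u, v) \<in> pres_rel X R \<Longrightarrow> u \<in> words X \<and> v \<in> words X"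
  by (induction rule: pres_rel.induct) auto

lemma equiv_pres_rel: "equiv (words X) (pres_rel X R)"
proof (rule equivI)
  show "pres_rel X R \<subseteq> words X \<times> words X" by (auto dest: pres_rel_words)
  show "refl_on (words X) (pres_rel X R)" by (auto simp: refl_on_def intro: pres_rel.refl)
  show "sym (pres_rel X R)" by (auto simp: sym_def intro: pres_rel.sym)
  show "trans (pres_rel X R)" by (rule transI) (rule pres_rel.trans)
qed

lemma pres_rel_append_left:
  "(u, v) \<in> pres_rel X R \<Longrightarrow> w \<in> words X \<Longrightarrow> (w @ u, w @ v) \<in> pres_rel X R"
proof (induction rule: pres_rel.induct)
  case (cancel u v x b)
  then show ?case using pres_rel.cancel[of "w @ u" X v x b R] by simp
next
  case (relator u v r)
  then show ?case using pres_rel.relator[of "w @ u" X v r R] by simp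
qed (auto intro: pres_rel.refl pres_rel.sym pres_rel.trans)

lemma pres_rel_append_right:
  "(u, v) \<in> pres_rel X R \<Longrightarrow> w \<in> words X \<Longrightarrow> (u @ w, v @ w) \<in> pres_rel X R"
proof (induction rule: pres_rel.induct)
  case (cancel u v x b)
  then show ?case using pres_rel.cancel[of u X "v @ w" x b R] by simp
next
  case (relator u v r)
  then show ?case using pres_rel.relator[of u X "v @ w" r R] by simp
qed (auto intro: pres_rel.refl pres_rel.sym pres_rel.trans)

lemma pres_rel_append:
  assumes "(u, u') \<in> pres_rel X R" "(v, v') \<in> pres_rel X R"
  shows "(u @ v, u' @ v') \<in> pres_rel X R"
  using pres_rel_append_right[OF assms(1)] pres_rel_append_left[OF assms(2)] pres_rel_words assms
  by (blast intro: pres_rel.trans)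

definition word_inv :: "'a word \<Rightarrow> 'a word" where
  "word_inv u = rev (map (\<lambda>(x, b). (x, \<not> b)) u)"

lemma word_inv_words [simp]: "word_inv u \<in> words X \<longleftrightarrow> u \<in> words X"
  by (auto simp: word_inv_def words_def)

lemma word_inv_word_inv [simp]: "word_inv (word_inv u) = u"
  by (induction u) (auto simp: word_inv_def)

lemma pres_rel_word_inv: "u \<in> words X \<Longrightarrow> (u @ word_inv u, []) \<in> pres_rel X R"
proof (induction u)
  case (Cons p u)
  obtain x b where p: "p = (x, b)" by fastforce
  have "([(x, b)] @ (u @ word_inv u) @ [(x, \<not> b)], [(x, b)] @ [] @ [(x, \<not> b)]) \<in> pres_rel X R"
    using Cons p by (intro pres_rel_append Cons.IH) (auto intro: pres_rel.refl)
  moreover have "([] @ [(x, b), (x, \<not> b)] @ [], [] @ []) \<in> pres_rel X R"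
    using Cons p by (intro pres_rel.cancel) auto
  ultimately show ?case using p by (auto simp: word_inv_def intro: pres_rel.trans)
qed (auto simp: word_inv_def intro: pres_rel.refl)

definition word_class :: "'a set \<Rightarrow> 'a word set \<Rightarrow> 'a word \<Rightarrow> 'a word set" where
  "word_class X R u = pres_rel X R `` {u}"

lemma word_class_eq_iff:
  "u \<in> words X \<Longrightarrow> v \<in> words X \<Longrightarrow> word_class X R u = word_class X R v \<longleftrightarrow> (u, v) \<in> pres_rel X R"
  unfolding word_class_def by (rule eq_equiv_class_iff[OF equiv_pres_rel])

lemma carrier_presented_group: "carrier (presented_group X R) = word_class X R ` words X"
  by (auto simp: presented_group_def quotient_def word_class_def)

lemma one_presented_group: "\<one>\<^bsub>presented_group X R\<^esub> = word_class X R []"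
  by (simp add: presented_group_def word_class_def)

lemma mult_word_class:
  assumes "u \<in> words X" "v \<in> words X"
  shows "word_class X R u \<otimes>\<^bsub>presented_group X R\<^esub> word_class X R v = word_class X R (u @ v)"
proof -
  have "pres_rel X R `` {a @ b} = word_class X R (u @ v)"
    if "a \<in> word_class X R u" "b \<in> word_class X R v" for a b
  proof -
    have "(u @ v, a @ b) \<in> pres_rel X R"
      using that by (intro pres_rel_append) (auto simp: word_class_def)
    then show ?thesis
      using equiv_class_eq[OF equiv_pres_rel] unfolding word_class_def by metis
  qed
  moreover have "u \<in> word_class X R u" "v \<in> word_class X R v"
    using assms by (auto simp: word_class_def intro: pres_rel.refl)
  ultimately have "(\<Union>a\<in>word_class X R u. \<Union>b\<in>word_class X R v. pres_rel X R `` {a @ b})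
      = word_class X R (u @ v)" by blast
  then show ?thesis by (simp add: presented_group_def)
qed

lemma group_presented_group: "group (presented_group X R)"
proof (rule groupI)
  fix C assume "C \<in> carrier (presented_group X R)"
  then obtain u where u: "u \<in> words X" "C = word_class X R u" by (auto simp: carrier_presented_group)
  have "word_class X R (word_inv u @ u) = word_class X R []"
    using pres_rel_word_inv[of "word_inv u" X R] u by (subst word_class_eq_iff) auto
  then show "\<exists>D\<in>carrier (presented_group X R). D \<otimes>\<^bsub>presented_group X R\<^esub> C = \<one>\<^bsub>presented_group X R\<^esub>"
    using u by (intro bexI[of _ "word_class X R (word_inv u)"])
      (auto simp: carrier_presented_group mult_word_class one_presented_group)
qed (auto simp: carrier_presented_group mult_word_class one_presented_group)

lemma presented_group_generated:
  "carrier (presented_group X R) \<subseteq>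
    generate (presented_group X R) ((\<lambda>x. word_class X R [(x, True)]) ` X)" (is "_ \<subseteq> ?H")
proof -
  interpret P: group "presented_group X R" by (rule group_presented_group)
  have "word_class X R u \<in> ?H" if "u \<in> words X" for u
    using that
  proof (induction u)
    case Nil
    show ?case using generate.one[of "presented_group X R"] by (simp add: one_presented_group)
  next
    case (Cons p u)
    obtain x b where p: "p = (x, b)" by fastforce
    with Cons have x: "x \<in> X" by simp
    have "word_class X R [(x, b)] \<in> ?H"
    proof (cases b)
      case True
      then show ?thesis using x by (auto intro: generate.incl)
    next
      case False
      have "word_class X R [(x, False)] \<otimes>\<^bsub>presented_group X R\<^esub> word_class X R [(x, True)] = \<one>\<^bsub>presented_group X R\<^esub>"
        using x pres_rel.cancel[of "[]" X "[]" x False R]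
        by (simp add: mult_word_class one_presented_group word_class_eq_iff)
      then have "word_class X R [(x, False)] = inv\<^bsub>presented_group X R\<^esub> word_class X R [(x, True)]"
        using x by (intro P.inv_equality[symmetric]) (auto simp: carrier_presented_group)
      with False x show ?thesis by (auto intro: generate.inv)
    qed
    then have "word_class X R [p] \<otimes>\<^bsub>presented_group X R\<^esub> word_class X R u \<in> ?H"
      using Cons p by (intro generate.eng) auto
    then show ?case using Cons p by (simp add: mult_word_class)
  qed
  then show ?thesis by (auto simp: carrier_presented_group)
qed

text \<open>The universal property of a presentation, for actions: operators attached to the letters
  that respect cancellation and relators depend only on the class of the word.\<close>

lemma foldr_pres_rel:
  assumes "(u, v) \<in> pres_rel X R"
    and "\<And>x b f. A (x, b) (A (x, \<not> b) f) = f" and "\<And>r f. r \<in> R \<Longrightarrow> foldr A r f = f"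
  shows "foldr A u f = foldr A v f"
  using assms(1) by (induction arbitrary: f rule: pres_rel.induct) (simp_all add: assms(2,3))

section \<open>The Magnus action of words\<close>

context commutation_graph
begin

definition shift :: "'v \<Rightarrow> ('v list \<Rightarrow> int) \<Rightarrow> 'v list \<Rightarrow> int" where
  "shift v f t = f t + strip_val f (strip v t)"

text \<open>The series 1 - X_v + X_v^2 - ..., inverse to \<open>shift v\<close>; at each list it is
  a finite sum because \<open>strip\<close> shortens.\<close>

function unshift :: "'v \<Rightarrow> ('v list \<Rightarrow> int) \<Rightarrow> 'v list \<Rightarrow> int" where
  "unshift v f t = f t - (case strip v t of None \<Rightarrow> 0 | Some u \<Rightarrow> unshift v f u)"
  by auto
termination
  by (relation "measure (\<lambda>(v, f, t). length t)") (auto dest: strip_length)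

declare unshift.simps [simp del]

lemma shift_unshift: "shift v (unshift v f) = f"
proof
  fix t
  show "shift v (unshift v f) t = f t"
    by (simp add: shift_def strip_val_def unshift.simps[of v f t])
qed

lemma unshift_shift: "unshift v (shift v f) = f"
proof
  fix t
  show "unshift v (shift v f) t = f t"
  proof (induction t rule: length_induct)
    case (1 t)
    then show ?case
      by (cases "strip v t")
        (auto simp: unshift.simps[of v "shift v f" t] shift_def[of v f t] dest: strip_length)
  qed
qed

lemma shift_commute:
  assumes "adj v w"
  shows "shift v (shift w f) = shift w (shift v f)"
proof
  fix t
  have "strip_val (\<lambda>u. strip_val f (strip w u)) (strip v t)
      = strip_val (\<lambda>u. strip_val f (strip v u)) (strip w t)"
    using arg_cong[OF strip_commute[OF assms, of t], of "strip_val f"] by (simp add: strip_val_bind)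
  then show "shift v (shift w f) t = shift w (shift v f) t"
    by (simp add: shift_def[abs_def] strip_val_add)
qed

definition letter_action :: "'v \<times> bool \<Rightarrow> ('v list \<Rightarrow> int) \<Rightarrow> 'v list \<Rightarrow> int" where
  "letter_action p = (if snd p then shift (fst p) else unshift (fst p))"

lemma letter_action_cancel: "letter_action (x, b) (letter_action (x, \<not> b) f) = f"
  by (simp add: letter_action_def shift_unshift unshift_shift)

lemma letter_action_commutator:
  "adj v w \<Longrightarrow> foldr letter_action [(v, True), (w, True), (v, False), (w, False)] f = f"
  by (simp add: letter_action_def shift_unshift shift_commute[of v w])

end

section \<open>The action of a right-angled Artin group\<close>

abbreviation raag_relators :: "'v pair_pre_digraph \<Rightarrow> 'v word set" where
  "raag_relators \<Gamma> \<equiv> {[(v, True), (w, True), (v, False), (w, False)] | v w. (v, w) \<in> parcs \<Gamma>}"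

definition raag_class :: "'v pair_pre_digraph \<Rightarrow> 'v word \<Rightarrow> 'v word set" where
  "raag_class \<Gamma> = word_class (pverts \<Gamma>) (raag_relators \<Gamma>)"

definition raag_gen :: "'v pair_pre_digraph \<Rightarrow> 'v \<Rightarrow> 'v word set" where
  "raag_gen \<Gamma> v = raag_class \<Gamma> [(v, True)]"

text \<open>On group elements the choice of representative is immaterial by
  \<open>foldr_pres_rel\<close>.\<close>

definition raag_action ::
  "'v pair_pre_digraph \<Rightarrow> 'v word set \<Rightarrow> ('v list \<Rightarrow> int) \<Rightarrow> 'v list \<Rightarrow> int" where
  "raag_action \<Gamma> C = foldr (commutation_graph.letter_action (\<lambda>v w. (v, w) \<in> parcs \<Gamma>)) (SOME u. u \<in> C)"

lemma magnus_action_raag: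
  assumes "pair_graph \<Gamma>"
  shows "magnus_action (raag \<Gamma>) (\<lambda>v w. (v, w) \<in> parcs \<Gamma>) (pverts \<Gamma>) (raag_gen \<Gamma>) (raag_action \<Gamma>)"
proof -
  interpret pair_graph \<Gamma> by (rule assms)
  interpret C: commutation_graph "\<lambda>v w. (v, w) \<in> parcs \<Gamma>"
    by unfold_locales (auto intro: arcs_symmetric dest: no_loops')
  interpret group "raag \<Gamma>" unfolding raag_def by (rule group_presented_group)
  have carrier: "carrier (raag \<Gamma>) = raag_class \<Gamma> ` words (pverts \<Gamma>)"
    by (simp add: raag_def raag_class_def carrier_presented_group)
  have mult: "raag_class \<Gamma> u \<otimes>\<^bsub>raag \<Gamma>\<^esub> raag_class \<Gamma> v = raag_class \<Gamma> (u @ v)"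
    if "u \<in> words (pverts \<Gamma>)" "v \<in> words (pverts \<Gamma>)" for u v
    using that by (simp add: raag_def raag_class_def mult_word_class)
  have one: "\<one>\<^bsub>raag \<Gamma>\<^esub> = raag_class \<Gamma> []"
    by (simp add: raag_def raag_class_def one_presented_group)
  have action: "raag_action \<Gamma> (raag_class \<Gamma> u) f = foldr C.letter_action u f"
    if u: "u \<in> words (pverts \<Gamma>)" for u f
  proof -
    have "u \<in> raag_class \<Gamma> u"
      using u by (auto simp: raag_class_def word_class_def intro: pres_rel.refl)
    then have "(SOME v. v \<in> raag_class \<Gamma> u) \<in> raag_class \<Gamma> u" by (rule someI)
    then have "(u, SOME v. v \<in> raag_class \<Gamma> u) \<in> pres_rel (pverts \<Gamma>) (raag_relators \<Gamma>)"
      by (simp add: raag_class_def word_class_def)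
    then have "foldr C.letter_action u f = foldr C.letter_action (SOME v. v \<in> raag_class \<Gamma> u) f"
      by (rule foldr_pres_rel) (use C.letter_action_cancel C.letter_action_commutator in blast)+
    then show ?thesis by (simp add: raag_action_def)
  qed
  show ?thesis
  proof unfold_locales
    fix v assume v: "v \<in> pverts \<Gamma>"
    show gen: "raag_gen \<Gamma> v \<in> carrier (raag \<Gamma>)"
      using v by (auto simp: carrier raag_gen_def)
    show "raag_action \<Gamma> (raag_gen \<Gamma> v) f t = f t + C.strip_val f (C.strip v t)" for f t
      using v by (simp add: raag_gen_def action C.letter_action_def C.shift_def)
    fix w assume w: "w \<in> pverts \<Gamma>" and vw: "(v, w) \<in> parcs \<Gamma>"
    let ?r = "[(v, True), (w, True), (v, False), (w, False)]" and ?s = "[(w, True), (v, True)]"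
    \<comment> \<open>The relator is put in front of w v; cancelling first w and then v in the
      product leaves v w.\<close>
    have P: "([] @ ?r @ ?s, [] @ ?s) \<in> pres_rel (pverts \<Gamma>) (raag_relators \<Gamma>)"
      using v w vw by (intro pres_rel.relator) auto
    have Q: "([(v, True), (w, True), (v, False)] @ [(w, False), (w, \<not> False)] @ [(v, True)],
        [(v, True), (w, True), (v, False)] @ [(v, True)]) \<in> pres_rel (pverts \<Gamma>) (raag_relators \<Gamma>)"
      using v w by (intro pres_rel.cancel) auto
    have S: "([(v, True), (w, True)] @ [(v, False), (v, \<not> False)] @ [],
        [(v, True), (w, True)] @ []) \<in> pres_rel (pverts \<Gamma>) (raag_relators \<Gamma>)"
      using v w by (intro pres_rel.cancel) auto
    have "([(v, True), (w, True)], ?s) \<in> pres_rel (pverts \<Gamma>) (raag_relators \<Gamma>)"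
      using P Q S unfolding append.simps not_False_eq_True by (meson pres_rel.trans pres_rel.sym)
    then show "raag_gen \<Gamma> v \<otimes>\<^bsub>raag \<Gamma>\<^esub> raag_gen \<Gamma> w = raag_gen \<Gamma> w \<otimes>\<^bsub>raag \<Gamma>\<^esub> raag_gen \<Gamma> v"
      using v w unfolding raag_gen_def by (simp add: mult) (simp add: raag_class_def word_class_eq_iff)
  next
    show "carrier (raag \<Gamma>) \<subseteq> generate (raag \<Gamma>) (raag_gen \<Gamma> ` pverts \<Gamma>)"
      using presented_group_generated[of "pverts \<Gamma>" "raag_relators \<Gamma>"]
      by (simp add: raag_def raag_gen_def[abs_def] raag_class_def)
  next
    fix g h f assume "g \<in> carrier (raag \<Gamma>)" "h \<in> carrier (raag \<Gamma>)"
    then show "raag_action \<Gamma> (g \<otimes>\<^bsub>raag \<Gamma>\<^esub> h) f = raag_action \<Gamma> g (raag_action \<Gamma> h f)"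
      by (auto simp: carrier mult action)
  next
    fix f show "raag_action \<Gamma> \<one>\<^bsub>raag \<Gamma>\<^esub> f = f" by (simp add: one action)
  qed
qed

section \<open>Outer automorphisms\<close>

text \<open>\<open>conjugation_is_hom\<close> maps into all bijections of the carrier. Once each
  conjugation is seen to be an automorphism, \<open>Inn G\<close> is the image of a homomorphism
  into \<open>AutoGroup G\<close>.\<close>

lemma (in group) Inn_subgroup: "subgroup (Inn G) (AutoGroup G)"
proof -
  let ?\<phi> = "\<lambda>g. \<lambda>x\<in>carrier G. g \<otimes> x \<otimes> inv g"
  have "?\<phi> g \<in> auto G" if g: "g \<in> carrier G" for g
  proof -
    have "?\<phi> g \<in> hom G G" using g by (intro homI) (auto simp: m_assoc)
    moreover have "?\<phi> g \<in> Bij (carrier G)"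
      using hom_in_carrier[OF conjugation_is_hom g] by (simp add: BijGroup_def)
    ultimately show ?thesis by (simp add: auto_def)
  qed
  then have "?\<phi> \<in> hom G (AutoGroup G)"
    using conjugation_is_hom by (auto simp: hom_def AutoGroup_def)
  then interpret group_hom G "AutoGroup G" ?\<phi>
    using AutoGroup by (simp add: group_hom_def group_hom_axioms_def)
  show ?thesis unfolding Inn_def by (rule img_is_subgroup)
qed

lemma (in group) subgroup_lower_central_series: "subgroup (lower_central_series G (Suc c)) G"
proof (induction c)
  case (Suc c)
  then have "lower_central_series G (Suc c) \<subseteq> carrier G" by (rule subgroup.subset)
  then show ?case unfolding lower_central_series.simps commutator_subgroup_def
    by (intro generate_is_subgroup) auto
qed (simp add: subgroup_self)

text \<open>The identity maps each coset to itself as a set. This puts the trivial outer class into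
  every \<open>H_sub\<close>.\<close>

lemma (in group) one_G_sub: "\<one>\<^bsub>AutoGroup G\<^esub> \<in> G_sub G c"
proof -
  have "(\<lambda>x\<in>carrier G. x) ` (lower_central_series G (Suc c) #> y) = lower_central_series G (Suc c) #> y"
    if "y \<in> carrier G" for y
  proof -
    have "lower_central_series G (Suc c) #> y \<subseteq> carrier G"
      using that subgroup.subset[OF subgroup_lower_central_series] by (rule r_coset_subset_G[rotated])
    then show ?thesis by (force simp: image_iff)
  qed
  then show ?thesis
    using id_in_auto unfolding G_sub_def kernel_def induced_auto_def
    by (auto simp: AutoGroup_def BijGroup_def carrier_FactGroup restrict_def fun_eq_iff)
qed

lemma (in group) G_sub_coset:
  assumes "\<alpha> \<in> G_sub G c" "x \<in> carrier G"
  obtains n where "n \<in> lower_central_series G (Suc c)" "\<alpha> x = n \<otimes> x"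
proof -
  let ?N = "lower_central_series G (Suc c)"
  have C: "?N #> x \<in> carrier (G Mod ?N)" using assms(2) by (simp add: carrier_FactGroup)
  have "induced_auto G ?N \<alpha> = \<one>\<^bsub>AutoGroup (G Mod ?N)\<^esub>"
    using assms(1) by (simp add: G_sub_def kernel_def)
  from fun_cong[OF this, of "?N #> x"] have "\<alpha> ` (?N #> x) = ?N #> x"
    using C by (simp add: induced_auto_def AutoGroup_def BijGroup_def)
  then have "\<alpha> x \<in> ?N #> x" using rcos_self[OF assms(2) subgroup_lower_central_series] by blast
  then show ?thesis using that by (auto simp: r_coset_def)
qed

lemma (in group) auto_eq_conj_on_coset:
  assumes "\<alpha> \<in> Inn G #>\<^bsub>AutoGroup G\<^esub> \<beta>" "\<beta> \<in> auto G"
  obtains g where "g \<in> carrier G" "\<And>x. x \<in> carrier G \<Longrightarrow> \<alpha> x = g \<otimes> \<beta> x \<otimes> inv g"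
proof -
  obtain \<iota> where i: "\<iota> \<in> Inn G" "\<alpha> = \<iota> \<otimes>\<^bsub>AutoGroup G\<^esub> \<beta>" using assms(1) by (auto simp: r_coset_def)
  then obtain g where g: "g \<in> carrier G" "\<iota> = (\<lambda>x\<in>carrier G. g \<otimes> x \<otimes> inv g)" by (auto simp: Inn_def)
  have "\<iota> \<in> auto G" using subgroup.subset[OF Inn_subgroup] i(1) by (auto simp: AutoGroup_def)
  then have "\<alpha> = compose (carrier G) \<iota> \<beta>"
    using i(2) assms(2) by (simp add: AutoGroup_def BijGroup_def auto_def)
  moreover have "\<beta> x \<in> carrier G" if "x \<in> carrier G" for x
    using assms(2) that by (auto simp: auto_def hom_def)
  ultimately show ?thesis using that[of g] g by (simp add: compose_def)
qed

section \<open>The intersection in the outer automorphism group\<close>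

theorem proposition4p7:
  fixes \<Gamma> :: "'v pair_pre_digraph"
  assumes "pair_graph \<Gamma>"
  shows "(\<Inter>c\<in>{1::nat..}. H_sub (raag \<Gamma>) c) = {\<one>\<^bsub>Out (raag \<Gamma>)\<^esub>}"
proof -
  interpret pair_graph \<Gamma> by (rule assms)
  let ?A = "raag \<Gamma>" and ?gen = "raag_gen \<Gamma>"
  interpret M: magnus_action ?A "\<lambda>v w. (v, w) \<in> parcs \<Gamma>" "pverts \<Gamma>" ?gen "raag_action \<Gamma>"
    by (rule magnus_action_raag[OF assms])
  interpret Aut: group "AutoGroup ?A" by (rule M.AutoGroup)
  have one: "\<one>\<^bsub>Out ?A\<^esub> = Inn ?A" by (simp add: Out_def)
  have "Inn ?A \<in> H_sub ?A c" for c
    unfolding H_sub_def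
    using M.one_G_sub[of c] Aut.coset_mult_one[OF subgroup.subset[OF M.Inn_subgroup]]
    by (intro image_eqI[of _ _ "\<one>\<^bsub>AutoGroup ?A\<^esub>"]) simp_all
  moreover have "C = Inn ?A" if C: "\<And>c. c \<ge> 1 \<Longrightarrow> C \<in> H_sub ?A c" for C
  proof -
    have G_auto: "\<beta> \<in> auto ?A" if "\<beta> \<in> G_sub ?A c" for \<beta> c
      using that by (simp add: G_sub_def kernel_def AutoGroup_def)
    \<comment> \<open>One representative of the coset is fixed. Those that come from the other
      indices differ from it by inner automorphisms.\<close>
    obtain \<alpha> where \<alpha>: "\<alpha> \<in> G_sub ?A 1" "C = Inn ?A #>\<^bsub>AutoGroup ?A\<^esub> \<alpha>"
      using C[of 1] by (auto simp: H_sub_def)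
    have auto: "\<alpha> \<in> carrier (AutoGroup ?A)" using G_auto[OF \<alpha>(1)] by (simp add: AutoGroup_def)
    have hom: "\<alpha> \<in> hom ?A ?A" and ext: "\<alpha> \<in> extensional (carrier ?A)"
      using G_auto[OF \<alpha>(1)] by (auto simp: auto_def Bij_def)
    interpret \<alpha>: group_hom ?A ?A \<alpha>
      using hom by (simp add: group_hom_def group_hom_axioms_def M.group_axioms)
    have "\<exists>g\<in>carrier ?A. \<forall>x\<in>pverts \<Gamma>.
        M.agree c (\<alpha> (?gen x)) (g \<otimes>\<^bsub>?A\<^esub> ?gen x \<otimes>\<^bsub>?A\<^esub> inv\<^bsub>?A\<^esub> g)" for c
    proof -
      \<comment> \<open>The index \<open>Suc c\<close> is at least 1 even for \<open>c = 0\<close>.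
        The factor \<open>n\<close> below then lies in term c + 2 of the lower central series and
        acts trivially at all lists of length at most \<open>c\<close>.\<close>
      obtain \<beta> where \<beta>: "\<beta> \<in> G_sub ?A (Suc c)" "C = Inn ?A #>\<^bsub>AutoGroup ?A\<^esub> \<beta>"
        using C[of "Suc c"] by (auto simp: H_sub_def)
      have "\<alpha> \<in> C" unfolding \<alpha>(2) by (rule Aut.rcos_self[OF auto M.Inn_subgroup])
      then obtain g where g: "g \<in> carrier ?A"
        "\<And>x. x \<in> carrier ?A \<Longrightarrow> \<alpha> x = g \<otimes>\<^bsub>?A\<^esub> \<beta> x \<otimes>\<^bsub>?A\<^esub> inv\<^bsub>?A\<^esub> g"
        using M.auto_eq_conj_on_coset[OF _ G_auto[OF \<beta>(1)]] \<beta>(2) by metis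
      have "M.agree c (\<alpha> (?gen x)) (g \<otimes>\<^bsub>?A\<^esub> ?gen x \<otimes>\<^bsub>?A\<^esub> inv\<^bsub>?A\<^esub> g)" if x: "x \<in> pverts \<Gamma>" for x
      proof -
        obtain n where n: "n \<in> lower_central_series ?A (Suc (Suc c))" "\<beta> (?gen x) = n \<otimes>\<^bsub>?A\<^esub> ?gen x"
          using M.G_sub_coset[OF \<beta>(1) M.gen_closed[OF x]] by blast
        have nd: "n \<in> M.dimension_subgroup (Suc (Suc c))"
          using n(1) M.lower_central_series_dimension_subgroup by blast
        note nc = M.dimension_subgroup_carrier[OF nd]
        have "M.agree c n \<one>\<^bsub>?A\<^esub>"
          using M.L_dimension_subgroup[OF nd] by (simp add: M.agree_def)
        then have "M.agree c (n \<otimes>\<^bsub>?A\<^esub> ?gen x) (\<one>\<^bsub>?A\<^esub> \<otimes>\<^bsub>?A\<^esub> ?gen x)"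
          using nc x by (intro M.agree_mult_right) auto
        then have "M.agree c (g \<otimes>\<^bsub>?A\<^esub> (n \<otimes>\<^bsub>?A\<^esub> ?gen x) \<otimes>\<^bsub>?A\<^esub> inv\<^bsub>?A\<^esub> g)
            (g \<otimes>\<^bsub>?A\<^esub> ?gen x \<otimes>\<^bsub>?A\<^esub> inv\<^bsub>?A\<^esub> g)"
          using nc x g(1) by (intro M.agree_conj) auto
        then show ?thesis using g(2)[OF M.gen_closed[OF x]] n(2) by simp
      qed
      with g(1) show ?thesis by blast
    qed
    from M.pro_inner[OF finite_verts _ this]
    obtain g where g: "g \<in> carrier ?A"
      "\<And>x. x \<in> pverts \<Gamma> \<Longrightarrow> \<alpha> (?gen x) = g \<otimes>\<^bsub>?A\<^esub> ?gen x \<otimes>\<^bsub>?A\<^esub> inv\<^bsub>?A\<^esub> g" by auto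
    let ?\<phi> = "\<lambda>x\<in>carrier ?A. g \<otimes>\<^bsub>?A\<^esub> x \<otimes>\<^bsub>?A\<^esub> inv\<^bsub>?A\<^esub> g"
    have "\<alpha> y = g \<otimes>\<^bsub>?A\<^esub> y \<otimes>\<^bsub>?A\<^esub> inv\<^bsub>?A\<^esub> g" if "y \<in> carrier ?A" for y
      using that
    proof (induction y rule: M.carrier_induct)
      case (inv v)
      then show ?case using g by (simp add: \<alpha>.hom_inv M.inv_mult_group M.m_assoc)
    qed (use g in \<open>simp_all add: M.m_assoc\<close>)
    then have "\<alpha> = ?\<phi>" using ext by (intro extensionalityI[of _ "carrier ?A"]) auto
    then have "\<alpha> \<in> Inn ?A" using g(1) by (auto simp: Inn_def)
    then show "C = Inn ?A" unfolding \<alpha>(2) by (rule Aut.coset_join2[OF auto M.Inn_subgroup])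
  qed
  ultimately show ?thesis unfolding one by (auto simp: atLeast_def)
qed

end
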